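(* Let $\tau_1,\tau_2\in L_2(0,1)$ be complex-valued functions and let $\mathcal L$ be the associated problem, with $\mathcal L\in\mathcal W$. Then the spectra $\mathfrak S_{12}$, $\mathfrak S_{13}$, $\mathfrak S_{23}$ coincide with the sets of zeros of the characteristic functions $\Delta_{22}(\lambda)$, $\Delta_{32}(\lambda)$, $\Delta_{42}(\lambda)$, respectively.
   Context: The formal differential expression is $l(y)=y^{(4)}-(py')'+qy$ on $(0,1)$ with $p\in W_2^{-1}(0,1)$, $q\in W_2^{-2}(0,1)$. It is regularized as follows. For complex-valued $\tau_1,\tau_2\in L_2(0,1)$ with $\tau_1'=p$, $\tau_2''=q$ in the sense of distributions, let $$F(x)=[f_{k,j}(x)]_{k,j=1}^4=\begin{pmatrix} 0 & 1 & 0 & 0 \\ -\tau_2 & \tau_1 & 1 & 0 \\ \tau_1\tau_2 & -\tau_1^2+2\tau_2 & -\tau_1 & 1 \\ \tau_2^2 & -\tau_1\tau_2 & -\tau_2 & 0 \end{pmatrix}.$$ Quasi-derivatives: $y^{[0]}=y$, $y^{[k]}=(y^{[k-1]})'-\sum_{j=1}^{k}f_{k,j}y^{[j-1]}$ for $k=1,\dots,4$. Domain: $\mathcal D_F=\{y: y^{[k]}\in AC[0,1],\ k=0,1,2,3\}$. For $\lambda\in\mathbb C$, a solution of the equation $l(y)=\lambda y$ means a function $y\in\mathcal D_F$ with $y^{[4]}=\lambda y$ a.e. on $(0,1)$. Linear forms: $U_s(y)=y^{[s-1]}(0)$ for $s=1,2,3,4$, and $V_1(y)=y^{[3]}(1)$,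 $V_2(y)=y^{[1]}(1)$, $V_3(y)=y^{[2]}(1)$, $V_4(y)=y(1)$. The problem $\mathcal L$ consists of $F$ together with these linear forms. Let $C_k(x,\lambda)$, $k=1,\dots,4$, be the solutions of $l(y)=\lambda y$ with $U_s(C_k)=\delta_{s,k}$, $s=1,\dots,4$. For $k=1,2,3$ put $\Delta_{kk}(\lambda)=\det[V_s(C_r)]_{s,r=k+1}^4$, and for $1\le k<j\le4$ let $\Delta_{jk}(\lambda)$ be the determinant obtained from $\Delta_{kk}(\lambda)$ by replacing $C_j$ by $C_k$. Thus $\Delta_{22}=\det\begin{pmatrix} V_3(C_3) & V_3(C_4) \\ V_4(C_3) & V_4(C_4) \end{pmatrix}$, $\Delta_{32}=\det\begin{pmatrix} V_3(C_2) & V_3(C_4) \\ V_4(C_2) & V_4(C_4) \end{pmatrix}$, $\Delta_{42}=\det\begin{pmatrix} V_3(C_3) & V_3(C_2) \\ V_4(C_3) & V_4(C_2) \end{pmatrix}$. One says $\mathcal L\in\mathcal W$ if all zeros of $\Delta_{kk}$ are simple for $k=1,2,3$, and $\Delta_{kk}$ and $\Delta_{k+1,k+1}$ have no common zeros for $k=1,2$. For $(i,j)\in\{(1,2),(1,3),(2,3)\}$, $\mathfrak S_{ij}$ is the spectrum of the boundary value problem $l(y)=\lambda y$, $U_i(y)=U_j(y)=0$, $V_3(y)=V_4(y)=0$, i.e. the set of $\lambda\in\mathbb C$ for which this problem has a nontrivial solution $y$. *)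

theory Defs
  imports "HOL-Analysis.Analysis" "Jordan_Normal_Form.Determinant"
begin

definition L2_01 :: "(real \<Rightarrow> complex) \<Rightarrow> bool" where
  "L2_01 f \<longleftrightarrow> f \<in> borel_measurable (lebesgue_on {0<..<1}) \<and>
     integrable (lebesgue_on {0<..<1}) (\<lambda>x. (cmod (f x))\<^sup>2)"

definition AC_01 :: "(real \<Rightarrow> complex) \<Rightarrow> bool" where
  "AC_01 f \<longleftrightarrow> (\<forall>\<epsilon>>0. \<exists>\<delta>>0. \<forall>(n::nat) u v.
     (\<forall>i<n. 0 \<le> u i \<and> u i \<le> v i \<and> v i \<le> (1::real)) \<longrightarrow>
     disjoint_family_on (\<lambda>i. {u i<..<v i}) {..<n} \<longrightarrow>
     (\<Sum>i<n. v i - u i) < \<delta> \<longrightarrow>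
     (\<Sum>i<n. cmod (f (v i) - f (u i))) < \<epsilon>)"

text \<open>The matrix associated with \<open>l(y) = y'''' - (p y')' + q y\<close>, where \<open>p = \<tau>1'\<close> and
  \<open>q = \<tau>2''\<close> in the sense of distributions; \<open>F_mat \<tau>1 \<tau>2 k j x\<close> is \<open>f\<^sub>k\<^sub>,\<^sub>j(x)\<close>,
  with indices running from 1 to 4.\<close>

definition F_mat :: "(real \<Rightarrow> complex) \<Rightarrow> (real \<Rightarrow> complex) \<Rightarrow> nat \<Rightarrow> nat \<Rightarrow> real \<Rightarrow> complex" where
  "F_mat \<tau>1 \<tau>2 k j x =
     [[0,              1,                          0,         0],
      [- \<tau>2 x,        \<tau>1 x,                      1,         0],
      [\<tau>1 x * \<tau>2 x,   - (\<tau>1 x)\<^sup>2 + 2 * \<tau>2 x,  - \<tau>1 x,   1],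
      [(\<tau>2 x)\<^sup>2,      - (\<tau>1 x * \<tau>2 x),          - \<tau>2 x,   0]] ! (k - 1) ! (j - 1)"

text \<open>\<open>quasi_chain \<tau>1 \<tau>2 y Y\<close> says that \<open>y\<close> has quasi-derivatives \<open>Y k\<close> for \<open>k = 0, ..., 4\<close>,
  those of order at most 3 being absolutely continuous. For \<open>k \<ge> 1\<close> the recursion determines
  \<open>Y k\<close> only almost everywhere. For \<open>k \<le> 3\<close> continuity then fixes its values on \<open>[0,1]\<close>,
  endpoints included.\<close>

definition quasi_chain ::
  "(real \<Rightarrow> complex) \<Rightarrow> (real \<Rightarrow> complex) \<Rightarrow> (real \<Rightarrow> complex) \<Rightarrow> (nat \<Rightarrow> real \<Rightarrow> complex) \<Rightarrow> bool" where
  "quasi_chain \<tau>1 \<tau>2 y Y \<longleftrightarrow> Y 0 = y \<and> (\<forall>k\<le>3. AC_01 (Y k)) \<and>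
     (\<forall>k\<in>{1..4}. AE x in lebesgue_on {0<..<1}.
        Y (k - 1) differentiable (at x) \<and>
        Y k x = vector_derivative (Y (k - 1)) (at x) - (\<Sum>j=1..k. F_mat \<tau>1 \<tau>2 k j x * Y (j - 1) x))"

definition D_F :: "(real \<Rightarrow> complex) \<Rightarrow> (real \<Rightarrow> complex) \<Rightarrow> (real \<Rightarrow> complex) set" where
  "D_F \<tau>1 \<tau>2 = {y. \<exists>Y. quasi_chain \<tau>1 \<tau>2 y Y}"

text \<open>\<open>quasi_deriv \<tau>1 \<tau>2 y k\<close> is \<open>y\<^sup>[\<^sup>k\<^sup>]\<close>; it is meaningful for \<open>y\<close> in \<open>D_F \<tau>1 \<tau>2\<close> and \<open>k \<le> 4\<close>,
  for \<open>k = 4\<close> up to a null set.\<close>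

definition quasi_deriv ::
  "(real \<Rightarrow> complex) \<Rightarrow> (real \<Rightarrow> complex) \<Rightarrow> (real \<Rightarrow> complex) \<Rightarrow> nat \<Rightarrow> real \<Rightarrow> complex" where
  "quasi_deriv \<tau>1 \<tau>2 y = (SOME Y. quasi_chain \<tau>1 \<tau>2 y Y)"

definition solution ::
  "(real \<Rightarrow> complex) \<Rightarrow> (real \<Rightarrow> complex) \<Rightarrow> complex \<Rightarrow> (real \<Rightarrow> complex) \<Rightarrow> bool" where
  "solution \<tau>1 \<tau>2 \<mu> y \<longleftrightarrow> y \<in> D_F \<tau>1 \<tau>2 \<and>
     (AE x in lebesgue_on {0<..<1}. quasi_deriv \<tau>1 \<tau>2 y 4 x = \<mu> * y x)"

definition U_form ::
  "(real \<Rightarrow> complex) \<Rightarrow> (real \<Rightarrow> complex) \<Rightarrow> nat \<Rightarrow> (real \<Rightarrow> complex) \<Rightarrow> complex" where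
  "U_form \<tau>1 \<tau>2 s y = quasi_deriv \<tau>1 \<tau>2 y (s - 1) 0"

text \<open>The orders of the quasi-derivatives in \<open>V\<^sub>1, V\<^sub>2, V\<^sub>3, V\<^sub>4\<close> are 3, 1, 2, 0.\<close>

definition V_form ::
  "(real \<Rightarrow> complex) \<Rightarrow> (real \<Rightarrow> complex) \<Rightarrow> nat \<Rightarrow> (real \<Rightarrow> complex) \<Rightarrow> complex" where
  "V_form \<tau>1 \<tau>2 s y = quasi_deriv \<tau>1 \<tau>2 y ([3, 1, 2, 0] ! (s - 1)) 1"

text \<open>\<open>C_sol \<tau>1 \<tau>2 k \<mu>\<close> is \<open>C\<^sub>k(\<cdot>, \<mu>)\<close>. Uniqueness holds only on \<open>[0,1]\<close>, since functions in
  \<open>D_F \<tau>1 \<tau>2\<close> are arbitrary outside this interval.\<close>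

definition C_sol ::
  "(real \<Rightarrow> complex) \<Rightarrow> (real \<Rightarrow> complex) \<Rightarrow> nat \<Rightarrow> complex \<Rightarrow> real \<Rightarrow> complex" where
  "C_sol \<tau>1 \<tau>2 k \<mu> = (SOME y. solution \<tau>1 \<tau>2 \<mu> y \<and>
     (\<forall>s\<in>{1..4}. U_form \<tau>1 \<tau>2 s y = (if s = k then 1 else 0)))"

text \<open>\<open>Delta \<tau>1 \<tau>2 j k\<close> is \<open>\<Delta>\<^sub>j\<^sub>k\<close> for \<open>k \<le> j\<close>. Rows and columns of the determinant are
  numbered from 0, so entry \<open>(s, r)\<close> corresponds to the indices \<open>s + k + 1\<close> and \<open>r + k + 1\<close>. For
  \<open>j = k\<close> no column is replaced.\<close>

definition Delta ::
  "(real \<Rightarrow> complex) \<Rightarrow> (real \<Rightarrow> complex) \<Rightarrow> nat \<Rightarrow> nat \<Rightarrow> complex \<Rightarrow> complex" where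
  "Delta \<tau>1 \<tau>2 j k \<mu> = Determinant.det (Matrix.mat (4 - k) (4 - k) (\<lambda>(s, r).
     V_form \<tau>1 \<tau>2 (s + k + 1)
       (C_sol \<tau>1 \<tau>2 (if r + k + 1 = j then k else r + k + 1) \<mu>)))"

definition class_W :: "(real \<Rightarrow> complex) \<Rightarrow> (real \<Rightarrow> complex) \<Rightarrow> bool" where
  "class_W \<tau>1 \<tau>2 \<longleftrightarrow>
     (\<forall>k\<in>{1..3}. \<forall>\<mu>. Delta \<tau>1 \<tau>2 k k \<mu> = 0 \<longrightarrow> deriv (Delta \<tau>1 \<tau>2 k k) \<mu> \<noteq> 0) \<and>
     (\<forall>k\<in>{1..2}. \<nexists>\<mu>. Delta \<tau>1 \<tau>2 k k \<mu> = 0 \<and> Delta \<tau>1 \<tau>2 (k + 1) (k + 1) \<mu> = 0)"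

definition spectrum_S ::
  "(real \<Rightarrow> complex) \<Rightarrow> (real \<Rightarrow> complex) \<Rightarrow> nat \<Rightarrow> nat \<Rightarrow> complex set" where
  "spectrum_S \<tau>1 \<tau>2 i j = {\<mu>. \<exists>y. solution \<tau>1 \<tau>2 \<mu> y \<and> (\<exists>x\<in>{0..1}. y x \<noteq> 0) \<and>
     U_form \<tau>1 \<tau>2 i y = 0 \<and> U_form \<tau>1 \<tau>2 j y = 0 \<and>
     V_form \<tau>1 \<tau>2 3 y = 0 \<and> V_form \<tau>1 \<tau>2 4 y = 0}"

end

theory Submission
  imports Defs
begin

text \<open>
  Write the equation \<open>l(y) = \<mu> y\<close> as the first-order system \<open>Y' = A Y\<close> for the vector of quasi-derivatives
  \<open>Y = (y\<^sup>[\<^sup>0\<^sup>], ..., y\<^sup>[\<^sup>3\<^sup>])\<close>. Since \<open>\<tau>1\<close> and \<open>\<tau>2\<close> are square integrable, the entries of \<open>A\<close> are integrable, so that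
  initial value problems are uniquely solvable within the absolutely continuous functions, and every
  solution is the combination of \<open>C\<^sub>1, ..., C\<^sub>4\<close> with coefficients \<open>U\<^sub>1(y), ..., U\<^sub>4(y)\<close>.
  A solution with \<open>U\<^sub>i(y) = U\<^sub>j(y) = 0\<close> therefore is \<open>a C\<^sub>k + b C\<^sub>l\<close> with \<open>{i, j, k, l} = {1, 2, 3, 4}\<close>, and it can be chosen
  nontrivial with \<open>V\<^sub>3(y) = V\<^sub>4(y) = 0\<close> iff the \<open>2 \<times> 2\<close> minor of \<open>[V\<^sub>3(C\<^sub>m), V\<^sub>4(C\<^sub>m)]\<close> with columns \<open>k, l\<close> vanishes
  (\<open>spectrum_iff_minor_eq_0\<close>). For the pairs \<open>(1,2)\<close> and \<open>(1,3)\<close> this minor, with columns \<open>3, 4\<close> or \<open>2, 4\<close>, is exactly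
  \<open>\<Delta>\<^sub>2\<^sub>2\<close> or \<open>\<Delta>\<^sub>3\<^sub>2\<close>.

  The pair \<open>(2,3)\<close> is different: its minor has the columns \<open>1, 4\<close>, whereas \<open>\<Delta>\<^sub>4\<^sub>2\<close> has the columns \<open>3, 2\<close> and so directly
  describes the problem with \<open>U\<^sub>1(y) = U\<^sub>4(y) = 0\<close>. The two agree because of formal self-adjointness. The form
  \<open>Y\<^sub>0 Z\<^sub>3 - Y\<^sub>1 Z\<^sub>2 + Y\<^sub>2 Z\<^sub>1 - Y\<^sub>3 Z\<^sub>0\<close> is constant in \<open>x\<close> for two solutions (\<open>Lagrange_identity\<close>), so the transfer matrix
  from \<open>0\<close> to \<open>1\<close> is symplectic, and hence so is its transpose (\<open>symplectic_transpose\<close>). The forms \<open>V\<^sub>4\<close> and \<open>V\<^sub>3\<close> are rows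
  \<open>0\<close> and \<open>2\<close> of the transfer matrix, which are orthogonal for the symplectic form; written out, this
  orthogonality says that the minors with columns \<open>1, 4\<close> and \<open>2, 3\<close> are equal.

  What this rests on is the theory of linear systems with integrable coefficients. Uniqueness and
  Lagrange's identity need that an absolutely continuous function is the integral of its almost everywhere
  derivative (\<open>AC_01_has_integral\<close>). Existence needs the converse, that an indefinite integral is absolutely continuous
  (\<open>AC_01_indefinite_integral\<close>) and has the integrand as its derivative almost everywhere
  (\<open>Lebesgue_differentiation\<close>).
\<close>

section \<open>Absolutely continuous functions are integrals of their derivatives\<close>

lemma AE_01_iff_negligible:
  "(AE x in lebesgue_on {0<..<1::real}. P x) \<longleftrightarrow> (\<exists>N. negligible N \<and> (\<forall>x\<in>{0<..<1} - N. P x))"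
proof -
  have "(AE x in lebesgue_on {0<..<1::real}. P x) \<longleftrightarrow> (AE x in lebesgue. x \<in> {0<..<1} \<longrightarrow> P x)"
    by (subst AE_restrict_space_iff) auto
  also have "\<dots> \<longleftrightarrow> (\<exists>N. negligible N \<and> (\<forall>x\<in>{0<..<1} - N. P x))"
  proof
    assume "AE x in lebesgue. x \<in> {0<..<1} \<longrightarrow> P x"
    then obtain N where "N \<in> null_sets lebesgue" "{x \<in> space lebesgue. \<not> (x \<in> {0<..<1} \<longrightarrow> P x)} \<subseteq> N"
      unfolding eventually_ae_filter by blast
    then show "\<exists>N. negligible N \<and> (\<forall>x\<in>{0<..<1} - N. P x)"
      by (intro exI[of _ N]) (auto simp: negligible_iff_null_sets)
  next
    assume "\<exists>N. negligible N \<and> (\<forall>x\<in>{0<..<1} - N. P x)"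
    then obtain N where "N \<in> null_sets lebesgue" "\<forall>x\<in>{0<..<1} - N. P x"
      by (auto simp: negligible_iff_null_sets)
    then show "AE x in lebesgue. x \<in> {0<..<1} \<longrightarrow> P x"
      by (intro AE_I'[of N]) auto
  qed
  finally show ?thesis .
qed

lemma sum_lengths_le_measure:
  fixes u v :: "'i \<Rightarrow> real"
  assumes fin: "finite I" and uv: "\<And>i. i \<in> I \<Longrightarrow> u i \<le> v i"
    and disj: "disjoint_family_on (\<lambda>i. {u i<..<v i}) I"
    and sub: "\<And>i. i \<in> I \<Longrightarrow> {u i<..<v i} \<subseteq> T" and T: "T \<in> lmeasurable"
  shows "(\<Sum>i\<in>I. v i - u i) \<le> measure lebesgue T"
proof -
  have "(\<Sum>i\<in>I. v i - u i) = (\<Sum>i\<in>I. measure lebesgue {u i<..<v i})"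
    using uv by (intro sum.cong) auto
  also have "\<dots> = measure lebesgue (\<Union>i\<in>I. {u i<..<v i})"
  proof (rule measure_finite_Union[symmetric])
    show "emeasure lebesgue {u i<..<v i} \<noteq> \<infinity>" if "i \<in> I" for i
      using uv[OF that] by (simp add: emeasure_lborel_Ioo)
  qed (use fin disj in auto)
  also have "\<dots> \<le> measure lebesgue T"
    by (rule measure_mono_fmeasurable) (use sub T fin in auto)
  finally show ?thesis .
qed

text \<open>The definition speaks of families indexed by \<open>{..<n}\<close>. The Henstock sums below are indexed by
  tagged intervals.\<close>
lemma AC_01_finite_family:
  assumes "AC_01 f" "\<epsilon> > 0"
  obtains \<delta> where "\<delta> > 0"
    "\<And>(I :: 'i set) u v. \<lbrakk>finite I; \<And>i. i \<in> I \<Longrightarrow> 0 \<le> u i \<and> u i \<le> v i \<and> v i \<le> 1;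
       disjoint_family_on (\<lambda>i. {u i<..<v i}) I; (\<Sum>i\<in>I. v i - u i) < \<delta>\<rbrakk>
     \<Longrightarrow> (\<Sum>i\<in>I. cmod (f (v i) - f (u i))) < \<epsilon>"
proof -
  from assms have "\<exists>\<delta>>0. \<forall>(n::nat) u v.
     (\<forall>i<n. 0 \<le> u i \<and> u i \<le> v i \<and> v i \<le> (1::real)) \<longrightarrow>
     disjoint_family_on (\<lambda>i. {u i<..<v i}) {..<n} \<longrightarrow>
     (\<Sum>i<n. v i - u i) < \<delta> \<longrightarrow> (\<Sum>i<n. cmod (f (v i) - f (u i))) < \<epsilon>"
    unfolding AC_01_def by blast
  then obtain \<delta> where \<delta>: "\<delta> > 0" and D: "\<forall>(n::nat) u v.
     (\<forall>i<n. 0 \<le> u i \<and> u i \<le> v i \<and> v i \<le> (1::real)) \<longrightarrow>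
     disjoint_family_on (\<lambda>i. {u i<..<v i}) {..<n} \<longrightarrow>
     (\<Sum>i<n. v i - u i) < \<delta> \<longrightarrow> (\<Sum>i<n. cmod (f (v i) - f (u i))) < \<epsilon>"
    by (elim exE conjE)
  show thesis
  proof (rule that[OF \<delta>])
    fix I :: "'i set" and u v :: "'i \<Rightarrow> real"
    assume fin: "finite I" and uv: "\<And>i. i \<in> I \<Longrightarrow> 0 \<le> u i \<and> u i \<le> v i \<and> v i \<le> 1"
      and dis: "disjoint_family_on (\<lambda>i. {u i<..<v i}) I" and less: "(\<Sum>i\<in>I. v i - u i) < \<delta>"
    obtain h n where h: "bij_betw h {..<n::nat} I"
      using ex_bij_betw_nat_finite[OF fin] unfolding atLeast0LessThan by blast
    have inI: "h i \<in> I" if "i < n" for i using h that by (auto simp: bij_betw_def)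
    have "(\<Sum>i<n. cmod (f (v (h i)) - f (u (h i)))) < \<epsilon>"
    proof (rule D[rule_format])
      show "0 \<le> u (h i) \<and> u (h i) \<le> v (h i) \<and> v (h i) \<le> 1" if "i < n" for i
        by (rule uv[OF inI[OF that]])
      show "disjoint_family_on (\<lambda>i. {u (h i)<..<v (h i)}) {..<n}"
        unfolding disjoint_family_on_def
      proof (intro ballI impI)
        fix i j assume "i \<in> {..<n}" "j \<in> {..<n}" "i \<noteq> j"
        then have "h i \<noteq> h j" using bij_betw_imp_inj_on[OF h] by (meson inj_onD)
        then show "{u (h i)<..<v (h i)} \<inter> {u (h j)<..<v (h j)} = {}"
          using dis inI \<open>i \<in> {..<n}\<close> \<open>j \<in> {..<n}\<close> unfolding disjoint_family_on_def by blast
      qed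
      show "(\<Sum>i<n. v (h i) - u (h i)) < \<delta>"
        using less sum.reindex_bij_betw[OF h, of "\<lambda>i. v i - u i"] by simp
    qed
    then show "(\<Sum>i\<in>I. cmod (f (v i) - f (u i))) < \<epsilon>"
      using sum.reindex_bij_betw[OF h, of "\<lambda>i. cmod (f (v i) - f (u i))"] by simp
  qed
qed

text \<open>The gauge integral gives this without a covering theorem. Around a point of differentiability the gauge
  makes the increment of \<open>f\<close> close to \<open>f' x\<close> times the length. Around a point of the exceptional null set
  \<open>E\<close> it keeps the intervals inside an open set of small measure, and there absolute continuity makes the
  total increment of \<open>f\<close> small.\<close>
lemma AC_01_has_integral:
  assumes ac: "AC_01 f" and neg: "negligible N"
    and der: "\<And>x. x \<in> {0<..<1} - N \<Longrightarrow> (f has_vector_derivative f' x) (at x)"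
    and b: "b \<in> {0..1}"
  shows "(f' has_integral f b - f 0) {0..b}"
proof -
  \<comment> \<open>The end points join the exceptional set because the derivative is only known on the open interval;
    changing \<open>f'\<close> to \<open>0\<close> on \<open>E\<close> removes these tags from the Riemann sum.\<close>
  define E where "E = N \<union> {0, 1}"
  define g where "g x = (if x \<in> E then 0 else f' x)" for x
  have negE: "negligible E" unfolding E_def using neg by simp
  have "(g has_integral f b - f 0) {0..b}"
    unfolding has_integral_real
  proof (intro allI impI)
    fix e :: real assume "e > 0"
    then have e3: "e/3 > 0" by simp
    obtain \<delta> where \<delta>: "\<delta> > 0" and AC: "\<And>(I :: (real \<times> real set) set) u v.
       \<lbrakk>finite I; \<And>i. i \<in> I \<Longrightarrow> 0 \<le> u i \<and> u i \<le> v i \<and> v i \<le> 1;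
       disjoint_family_on (\<lambda>i. {u i<..<v i}) I; (\<Sum>i\<in>I. v i - u i) < \<delta>\<rbrakk>
     \<Longrightarrow> (\<Sum>i\<in>I. cmod (f (v i) - f (u i))) < e/3"
      using AC_01_finite_family[OF ac e3, where 'i = "real \<times> real set"] by blast
    obtain T where T: "open T" "E \<subseteq> T" "(T - E) \<in> lmeasurable" "emeasure lebesgue (T - E) < ennreal \<delta>"
      using sets_lebesgue_outer_open[OF _ \<delta>, of E] negE negligible_imp_sets by blast
    have Tm: "T \<in> lmeasurable"
      using fmeasurable.Un[OF T(3) negligible_imp_measurable[OF negE]] T(2)
      by (simp add: Un_absorb2)
    have "measure lebesgue T = measure lebesgue (T - E)"
      using negE Tm by (simp add: measure_Diff_null_set negligible_iff_null_sets fmeasurableD)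
    moreover have "measure lebesgue (T - E) < \<delta>"
      using T(3,4) \<delta> by (simp add: emeasure_eq_measure2 ennreal_less_iff)
    ultimately have mT: "measure lebesgue T < \<delta>" by simp
    have "\<exists>r. r > 0 \<and> (if x \<in> E then ball x r \<subseteq> T else x \<in> {0<..<1} \<longrightarrow>
            (\<forall>y. \<bar>y - x\<bar> < r \<longrightarrow> cmod (f y - f x - (y - x) *\<^sub>R f' x) \<le> e/3 * \<bar>y - x\<bar>))" for x
    proof (cases "x \<in> E")
      case True then show ?thesis using T by (metis open_contains_ball subsetD)
    next
      case False
      show ?thesis
      proof (cases "x \<in> {0<..<1}")
        case True
        then have "(f has_vector_derivative f' x) (at x)" using False der by (auto simp: E_def)
        then obtain d where "d > 0" "\<forall>y. norm (y - x) < d \<longrightarrow> norm (f y - f x - (y - x) *\<^sub>R f' x) \<le> e/3 * norm (y - x)"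
          using e3 unfolding has_vector_derivative_def has_derivative_at_alt by blast
        then show ?thesis using False by (intro exI[of _ d]) simp
      qed (use False in \<open>auto intro: exI[of _ 1]\<close>)
    qed
    then have "\<forall>x. \<exists>r. r > 0 \<and> (if x \<in> E then ball x r \<subseteq> T else x \<in> {0<..<1} \<longrightarrow>
            (\<forall>y. \<bar>y - x\<bar> < r \<longrightarrow> cmod (f y - f x - (y - x) *\<^sub>R f' x) \<le> e/3 * \<bar>y - x\<bar>))"
      by blast
    from choice[OF this] obtain r where R: "\<And>x. r x > 0 \<and> (if x \<in> E then ball x (r x) \<subseteq> T else x \<in> {0<..<1} \<longrightarrow>
            (\<forall>y. \<bar>y - x\<bar> < r x \<longrightarrow> cmod (f y - f x - (y - x) *\<^sub>R f' x) \<le> e/3 * \<bar>y - x\<bar>))"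
      by blast
    have r: "\<And>x. r x > 0" and rE: "\<And>x. x \<in> E \<Longrightarrow> ball x (r x) \<subseteq> T" using R by simp_all
    have rn: "cmod (f y - f x - (y - x) *\<^sub>R f' x) \<le> e/3 * \<bar>y - x\<bar>"
      if "x \<notin> E" "x \<in> {0<..<1}" "\<bar>y - x\<bar> < r x" for x y
      using R[of x] that by simp
    show "\<exists>\<gamma>. gauge \<gamma> \<and> (\<forall>\<D>. \<D> tagged_division_of {0..b} \<and> \<gamma> fine \<D> \<longrightarrow>
        norm ((\<Sum>(x, k)\<in>\<D>. measure lborel k *\<^sub>R g x) - (f b - f 0)) < e)"
    proof (intro exI conjI allI impI)
      show "gauge (\<lambda>x. ball x (r x))" using r by (simp add: gauge_ball_dependent)
    next
      fix p assume "p tagged_division_of {0..b} \<and> (\<lambda>x. ball x (r x)) fine p"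
      then have ptag: "p tagged_division_of {0..b}" and fine: "(\<lambda>x. ball x (r x)) fine p" by auto
      note pD = tagged_division_ofD[OF ptag]
      define u where "u = (\<lambda>i::real \<times> real set. Inf (snd i))"
      define v where "v = (\<lambda>i::real \<times> real set. Sup (snd i))"
      have iv: "snd i = {u i..v i}" "fst i \<in> {u i..v i}" "{u i..v i} \<subseteq> {0..b}" "u i \<le> v i"
          "{u i..v i} \<subseteq> ball (fst i) (r (fst i))" if i: "i \<in> p" for i
      proof -
        obtain x K where xK: "i = (x, K)" by force
        obtain c d where K: "K = {c..d}" using pD(4) i xK by (metis box_real(2))
        have "x \<in> K" using pD(2) i xK by blast
        then have uv: "u i = c" "v i = d" using K xK by (auto simp: u_def v_def)
        show "snd i = {u i..v i}" "fst i \<in> {u i..v i}" "u i \<le> v i"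
          using uv xK K \<open>x \<in> K\<close> by auto
        show "{u i..v i} \<subseteq> {0..b}" using pD(3) i xK uv K by blast
        show "{u i..v i} \<subseteq> ball (fst i) (r (fst i))"
          using fineD[OF fine] i xK uv K by auto
      qed
      have disj: "disjoint_family_on (\<lambda>i. {u i<..<v i}) p"
        unfolding disjoint_family_on_def
      proof (intro ballI impI)
        fix i j assume ij: "i \<in> p" "j \<in> p" "i \<noteq> j"
        have "interior (snd i) \<inter> interior (snd j) = {}"
          using pD(5)[of "fst i" "snd i" "fst j" "snd j"] ij by (auto simp: prod_eq_iff)
        then show "{u i<..<v i} \<inter> {u j<..<v j} = {}"
          using iv(1) ij by (simp add: interior_atLeastAtMost_real)
      qed
      have ba: "b = (\<Sum>i\<in>p. v i - u i)" "f b - f 0 = (\<Sum>i\<in>p. f (v i) - f (u i))"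
        using additive_tagged_division_1[OF _ ptag, of "\<lambda>x. x"] additive_tagged_division_1[OF _ ptag, of f] b
        by (auto simp: u_def v_def case_prod_beta)
      define t where "t i = (v i - u i) *\<^sub>R g (fst i) - (f (v i) - f (u i))" for i
      have "(\<Sum>(x, k)\<in>p. measure lborel k *\<^sub>R g x) = (\<Sum>i\<in>p. (v i - u i) *\<^sub>R g (fst i))"
        using iv by (intro sum.cong) (auto simp: case_prod_beta)
      then have eq: "(\<Sum>(x, k)\<in>p. measure lborel k *\<^sub>R g x) - (f b - f 0) = (\<Sum>i\<in>p. t i)"
        by (simp add: ba(2) t_def sum_subtractf)
      let ?P = "{i\<in>p. fst i \<in> E}" and ?Q = "{i\<in>p. fst i \<notin> E}"
      have P: "norm (\<Sum>i\<in>?P. t i) < e/3"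
      proof -
        have "(\<Sum>i\<in>?P. v i - u i) \<le> measure lebesgue T"
        proof (rule sum_lengths_le_measure)
          show "disjoint_family_on (\<lambda>i. {u i<..<v i}) ?P" using disj by (auto simp: disjoint_family_on_def)
          fix i assume i: "i \<in> ?P"
          have "{u i<..<v i} \<subseteq> {u i..v i}" by auto
          then show "{u i<..<v i} \<subseteq> T" using iv(5)[of i] rE[of "fst i"] i by blast
        qed (use pD(1) iv Tm in auto)
        then have "(\<Sum>i\<in>?P. v i - u i) < \<delta>" using mT by simp
        then have "(\<Sum>i\<in>?P. cmod (f (v i) - f (u i))) < e/3"
        proof (intro AC)
          show "disjoint_family_on (\<lambda>i. {u i<..<v i}) ?P" using disj by (auto simp: disjoint_family_on_def)
          show "0 \<le> u i \<and> u i \<le> v i \<and> v i \<le> 1" if "i \<in> ?P" for i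
            using iv(3,4)[of i] that b by auto
        qed (use pD(1) in auto)
        moreover have "norm (\<Sum>i\<in>?P. t i) \<le> (\<Sum>i\<in>?P. cmod (f (v i) - f (u i)))"
          by (rule sum_norm_le) (auto simp: t_def g_def norm_minus_commute)
        ultimately show ?thesis by simp
      qed
      have "norm (\<Sum>i\<in>?Q. t i) \<le> (\<Sum>i\<in>?Q. e/3 * (v i - u i))"
      proof (rule sum_norm_le)
        fix i assume i: "i \<in> ?Q"
        let ?x = "fst i"
        have x: "?x \<in> {u i..v i}" "?x \<notin> E" "?x \<in> {0<..<1}"
          using i iv(2,3)[of i] b by (auto simp: E_def less_eq_real_def)
        have "u i \<in> ball ?x (r ?x)" "v i \<in> ball ?x (r ?x)" using iv(4,5)[of i] i by auto
        then have "\<bar>u i - ?x\<bar> < r ?x" "\<bar>v i - ?x\<bar> < r ?x" by (auto simp: dist_real_def)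
        then have le: "cmod (f (u i) - f ?x - (u i - ?x) *\<^sub>R f' ?x) \<le> e/3 * \<bar>u i - ?x\<bar>"
             "cmod (f (v i) - f ?x - (v i - ?x) *\<^sub>R f' ?x) \<le> e/3 * \<bar>v i - ?x\<bar>"
          using rn x by blast+
        have "t i = (f (u i) - f ?x - (u i - ?x) *\<^sub>R f' ?x) - (f (v i) - f ?x - (v i - ?x) *\<^sub>R f' ?x)"
          using x by (simp add: t_def g_def algebra_simps)
        then have "norm (t i) \<le> cmod (f (u i) - f ?x - (u i - ?x) *\<^sub>R f' ?x) + cmod (f (v i) - f ?x - (v i - ?x) *\<^sub>R f' ?x)"
          by (simp only: norm_triangle_ineq4)
        then have "norm (t i) \<le> e/3 * \<bar>u i - ?x\<bar> + e/3 * \<bar>v i - ?x\<bar>"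
          using le by linarith
        also have "\<dots> = e/3 * (v i - u i)" using x by (simp add: field_simps)
        finally show "norm (t i) \<le> e/3 * (v i - u i)" .
      qed
      also have "\<dots> \<le> (\<Sum>i\<in>p. e/3 * (v i - u i))"
        using pD(1) iv(4) \<open>e > 0\<close> by (intro sum_mono2) auto
      also have "\<dots> = e/3 * b" by (simp add: ba(1) sum_distrib_left)
      also have "\<dots> \<le> e/3" using b \<open>e > 0\<close> by (simp add: mult_left_le)
      finally have Q: "norm (\<Sum>i\<in>?Q. t i) \<le> e/3" .
      have "?P \<union> ?Q = p" by blast
      then have "(\<Sum>i\<in>p. t i) = (\<Sum>i\<in>?P. t i) + (\<Sum>i\<in>?Q. t i)"
        using sum.union_disjoint[of ?P ?Q t] pD(1) by auto
      then have "norm (\<Sum>i\<in>p. t i) < e" using P Q \<open>e > 0\<close> norm_triangle_ineq[of "\<Sum>i\<in>?P. t i" "\<Sum>i\<in>?Q. t i"]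
        by simp
      then show "norm ((\<Sum>(x, k)\<in>p. measure lborel k *\<^sub>R g x) - (f b - f 0)) < e" unfolding eq .
    qed
  qed
  then show ?thesis
    by (rule has_integral_spike[OF negE, rotated]) (simp add: g_def)
qed

section \<open>Differentiation of indefinite integrals\<close>

text \<open>The points where the difference quotient of the integral misses \<open>g x\<close> by more than \<open>c\<close> at arbitrarily small
  scales are Vitali covered by intervals, tagged at an end point, on which Henstock's lemma bounds the summed defect.
  Each defect exceeds \<open>c\<close> times the length, so disjoint such intervals have small total length.\<close>
lemma negligible_derivative_defect:
  fixes g :: "real \<Rightarrow> 'a::euclidean_space"
  assumes int: "g integrable_on {a..b}" and c: "c > 0"
  defines "F \<equiv> \<lambda>x. integral {a..x} g"
  shows "negligible {x\<in>{a<..<b}. \<forall>d>0. \<exists>y\<in>{a<..<b}. \<bar>y - x\<bar> < d \<and>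
           norm (F y - F x - (y - x) *\<^sub>R g x) > c * \<bar>y - x\<bar>}" (is "negligible ?E")
  unfolding negligible_outer_le
proof (intro allI impI)
  fix e :: real assume "e > 0"
  then have ce: "c * e > 0" using c by simp
  have int': "g integrable_on cbox a b" using int by simp
  obtain \<gamma> where "gauge \<gamma>" and \<gamma>: "\<And>p. \<lbrakk>p tagged_partial_division_of (cbox a b); \<gamma> fine p\<rbrakk> \<Longrightarrow>
             sum (\<lambda>(x,k). norm(measure lborel k *\<^sub>R g x - integral k g)) p < c * e"
    using Henstock_lemma[OF int' ce] by blast
  \<comment> \<open>The covering theorem is about balls: the interval between \<open>x\<close> and \<open>y\<close>, tagged at \<open>x\<close>, is the ball
    with centre \<open>m (x, y)\<close> and radius \<open>r (x, y)\<close>.\<close>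
  define m where "m = (\<lambda>i::real\<times>real. (fst i + snd i) / 2)"
  define r where "r = (\<lambda>i::real\<times>real. \<bar>snd i - fst i\<bar> / 2)"
  define Kset where "Kset = {(x,y). x \<in> {a<..<b} \<and> y \<in> {a<..<b} \<and> cball (m (x,y)) (r (x,y)) \<subseteq> \<gamma> x \<and>
     norm (F y - F x - (y - x) *\<^sub>R g x) > c * \<bar>y - x\<bar>}"
  have cb: "cball (m i) (r i) = {min (fst i) (snd i)..max (fst i) (snd i)}" for i
    by (auto simp: m_def r_def cball_eq_atLeastAtMost min_def max_def abs_if field_simps)
  have rpos: "0 < r i" if "i \<in> Kset" for i
    using that by (auto simp: Kset_def r_def)
  have cover: "\<exists>i. i \<in> Kset \<and> x \<in> cball (m i) (r i) \<and> r i < d" if x: "x \<in> ?E" and "d > 0" for x d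
  proof -
    obtain \<rho> where \<rho>: "\<rho> > 0" "ball x \<rho> \<subseteq> \<gamma> x"
      using \<open>gauge \<gamma>\<close> by (meson gaugeD openE)
    obtain y where y: "y \<in> {a<..<b}" "\<bar>y - x\<bar> < min d \<rho>" "norm (F y - F x - (y - x) *\<^sub>R g x) > c * \<bar>y - x\<bar>"
      using x \<rho> \<open>d > 0\<close> by (auto dest!: spec[of _ "min d \<rho>"])
    have "cball (m (x,y)) (r (x,y)) \<subseteq> ball x \<rho>"
      using y(2) unfolding cb by (auto simp: dist_real_def)
    then have "(x,y) \<in> Kset" using x y \<rho> by (auto simp: Kset_def)
    moreover have "x \<in> cball (m (x,y)) (r (x,y))" unfolding cb by auto
    moreover have "r (x,y) < d" using y(2) \<open>d > 0\<close> by (auto simp: r_def)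
    ultimately show ?thesis by blast
  qed
  obtain C where C: "countable C" "C \<subseteq> Kset"
     "pairwise (\<lambda>i j. disjnt (cball (m i) (r i)) (cball (m j) (r j))) C"
     "negligible (?E - (\<Union>i \<in> C. cball (m i) (r i)))"
    using Vitali_covering_theorem_cballs[of Kset r ?E m, OF rpos cover] by blast
  have bound: "measure lebesgue (\<Union>i\<in>I. cball (m i) (r i)) \<le> e" if I: "I \<subseteq> C" "finite I" for I
  proof -
    define h where "h = (\<lambda>i::real\<times>real. (fst i, cball (m i) (r i)))"
    have dis: "cball (m i) (r i) \<inter> cball (m j) (r j) = {}" if "i \<in> I" "j \<in> I" "i \<noteq> j" for i j
      using C(3) I that unfolding pairwise_def disjnt_def by blast
    have mem: "fst i \<in> cball (m i) (r i)" for i unfolding cb by auto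
    have inj: "inj_on h I"
    proof (rule inj_onI)
      fix i j assume ij: "i \<in> I" "j \<in> I" "h i = h j"
      show "i = j" using dis[OF ij(1,2)] ij(3) mem[of i] unfolding h_def by blast
    qed
    have part: "(h ` I) tagged_partial_division_of cbox a b"
      unfolding tagged_partial_division_of_def
    proof (intro conjI allI impI)
      show "finite (h ` I)" using I by simp
      fix x k assume xk: "(x,k) \<in> h ` I"
      then obtain i where i: "i \<in> I" "x = fst i" "k = cball (m i) (r i)" by (auto simp: h_def)
      have "i \<in> Kset" using i I C by blast
      then show "k \<subseteq> cbox a b" unfolding i cb by (auto simp: Kset_def)
      show "x \<in> k" using i mem by simp
      show "\<exists>a b. k = cbox a b" unfolding i cb by (metis box_real(2))
    next
      fix x1 k1 x2 k2 assume "(x1, k1) \<in> h ` I \<and> (x2, k2) \<in> h ` I \<and> (x1, k1) \<noteq> (x2, k2)"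
      then obtain i j where ij: "i \<in> I" "j \<in> I" "i \<noteq> j" "k1 = cball (m i) (r i)" "k2 = cball (m j) (r j)"
        by (auto simp: h_def)
      then have "k1 \<inter> k2 = {}" using dis by blast
      then show "interior k1 \<inter> interior k2 = {}"
        using interior_subset[of k1] interior_subset[of k2] by blast
    qed
    have fine: "\<gamma> fine (h ` I)"
    proof (rule fineI, rule subsetI)
      fix x k y assume *: "(x, k) \<in> h ` I" "y \<in> k"
      then obtain i where i: "i \<in> I" "x = fst i" "k = cball (m i) (r i)" by (auto simp: h_def)
      have "i \<in> Kset" using i I C by blast
      then show "y \<in> \<gamma> x" using * unfolding i Kset_def by (auto simp: case_prod_beta)
    qed
    have "c * measure lebesgue (\<Union>i\<in>I. cball (m i) (r i)) \<le> c * (\<Sum>i\<in>I. measure lebesgue (cball (m i) (r i)))"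
      using c by (intro mult_left_mono measure_UNION_le) (auto simp: I)
    also have "\<dots> \<le> (\<Sum>i\<in>I. norm (measure lborel (cball (m i) (r i)) *\<^sub>R g (fst i) - integral (cball (m i) (r i)) g))"
      unfolding sum_distrib_left
    proof (rule sum_mono)
      fix i assume "i \<in> I"
      then have iK: "i \<in> Kset" using I C by blast
      obtain x y where i: "i = (x,y)" by force
      have xy: "x \<in> {a<..<b}" "y \<in> {a<..<b}" "norm (F y - F x - (y - x) *\<^sub>R g x) > c * \<bar>y - x\<bar>"
        using iK by (auto simp: Kset_def i)
      have split: "F (max x y) = F (min x y) + integral {min x y..max x y} g"
        unfolding F_def
        by (rule Henstock_Kurzweil_Integration.integral_combine[symmetric])
           (use xy in \<open>auto intro!: integrable_subinterval_real[OF int]\<close>)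
      have "norm (measure lborel {min x y..max x y} *\<^sub>R g x - integral {min x y..max x y} g) =
            norm (F y - F x - (y - x) *\<^sub>R g x)"
      proof (cases "x \<le> y")
        case True then show ?thesis using split
          by (simp add: min_def max_def norm_minus_commute)
      next
        case False then show ?thesis using split
          by (simp add: min_def max_def algebra_simps)
      qed
      then show "c * measure lebesgue (cball (m i) (r i)) \<le>
         norm (measure lborel (cball (m i) (r i)) *\<^sub>R g (fst i) - integral (cball (m i) (r i)) g)"
        using xy unfolding cb i by (auto simp: min_def max_def abs_if split: if_splits)
    qed
    also have "\<dots> = (\<Sum>(x,k)\<in>h ` I. norm (measure lborel k *\<^sub>R g x - integral k g))"
      by (subst sum.reindex[OF inj]) (simp add: h_def)
    also have "\<dots> < c * e" using \<gamma>[OF part fine] .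
    finally show ?thesis using c by simp
  qed
  have meas: "(\<Union>i\<in>C. cball (m i) (r i)) \<in> lmeasurable" 
    by (rule fmeasurable_UN_bound[OF C(1) _ bound]) auto
  have mle: "measure lebesgue (\<Union>i\<in>C. cball (m i) (r i)) \<le> e" 
    by (rule measure_UN_bound[OF C(1) _ bound]) auto
  let ?U = "\<Union>i\<in>C. cball (m i) (r i)"
  show "\<exists>T. ?E \<subseteq> T \<and> T \<in> lmeasurable \<and> measure lebesgue T \<le> e"
  proof (intro exI conjI)
    show "?E \<subseteq> ?U \<union> (?E - ?U)" by blast
    show "?U \<union> (?E - ?U) \<in> lmeasurable"
      using meas negligible_imp_measurable[OF C(4)] by (rule fmeasurable.Un)
    have "measure lebesgue (?U \<union> (?E - ?U)) \<le> measure lebesgue ?U + measure lebesgue (?E - ?U)"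
      using meas negligible_imp_measurable[OF C(4)] by (intro measure_Un_le) auto
    then show "measure lebesgue (?U \<union> (?E - ?U)) \<le> e"
      using mle negligible_imp_measure0[OF C(4)] by linarith
  qed
qed

theorem Lebesgue_differentiation:
  fixes g :: "real \<Rightarrow> 'a::euclidean_space"
  assumes int: "g integrable_on {a..b}"
  obtains N where "negligible N"
    "\<And>x. x \<in> {a<..<b} - N \<Longrightarrow> ((\<lambda>x. integral {a..x} g) has_vector_derivative g x) (at x)"
proof -
  define F where "F = (\<lambda>x. integral {a..x} g)"
  define E where "E = (\<lambda>n::nat. {x\<in>{a<..<b}. \<forall>d>0. \<exists>y\<in>{a<..<b}. \<bar>y - x\<bar> < d \<and>
           norm (F y - F x - (y - x) *\<^sub>R g x) > inverse (Suc n) * \<bar>y - x\<bar>})"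
  have "negligible (E n)" for n
    unfolding E_def F_def by (rule negligible_derivative_defect[OF int]) simp
  then have "negligible (\<Union>n. E n)" by (rule negligible_Union_nat)
  moreover have "(F has_vector_derivative g x) (at x)" if x: "x \<in> {a<..<b} - (\<Union>n. E n)" for x
    unfolding has_vector_derivative_def has_derivative_at_alt
  proof (intro conjI allI impI bounded_linear_scaleR_left)
    fix e :: real assume "e > 0"
    then obtain n where n: "inverse (real (Suc n)) < e" using reals_Archimedean by blast
    have "x \<notin> E n" using x by blast
    then obtain d where d: "d > 0" and D: "\<And>y. \<lbrakk>y\<in>{a<..<b}; \<bar>y - x\<bar> < d\<rbrakk> \<Longrightarrow>
           norm (F y - F x - (y - x) *\<^sub>R g x) \<le> inverse (Suc n) * \<bar>y - x\<bar>"
      using x unfolding E_def by (auto simp: not_less simp del: of_nat_Suc) (metis not_less greaterThanLessThan_iff)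
    have "\<exists>\<rho>>0. ball x \<rho> \<subseteq> {a<..<b}" using x by (metis Diff_iff openE open_greaterThanLessThan)
    then obtain \<rho> where \<rho>: "\<rho> > 0" "ball x \<rho> \<subseteq> {a<..<b}" by blast
    show "\<exists>d>0. \<forall>y. norm (y - x) < d \<longrightarrow> norm (F y - F x - (y - x) *\<^sub>R g x) \<le> e * norm (y - x)"
    proof (intro exI[of _ "min d \<rho>"] conjI allI impI)
      fix y assume "norm (y - x) < min d \<rho>"
      then have "y \<in> {a<..<b}" "\<bar>y - x\<bar> < d" using \<rho>(2) by (auto simp: dist_real_def subset_iff)
      then have "norm (F y - F x - (y - x) *\<^sub>R g x) \<le> inverse (Suc n) * \<bar>y - x\<bar>" by (rule D)
      also have "\<dots> \<le> e * \<bar>y - x\<bar>" using n by (intro mult_right_mono) auto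
      finally show "norm (F y - F x - (y - x) *\<^sub>R g x) \<le> e * norm (y - x)" by simp
    qed (use d \<rho> in auto)
  qed
  ultimately show thesis using that unfolding F_def by blast
qed

section \<open>Operations that preserve absolute continuity\<close>

lemma AC_01_const: "AC_01 (\<lambda>x. c)"
  by (auto simp: AC_01_def intro: exI[of _ 1])

text \<open>Sums and products both have increments bounded by those of the two arguments, so one lemma serves them.\<close>
lemma AC_01_of_increment_bound:
  assumes f: "AC_01 f" and g: "AC_01 g" and M: "M > 0"
    and le: "\<And>u v. \<lbrakk>0 \<le> u; u \<le> v; v \<le> 1\<rbrakk> \<Longrightarrow> cmod (h v - h u) \<le> M * (cmod (f v - f u) + cmod (g v - g u))"
  shows "AC_01 h"
  unfolding AC_01_def
proof (intro allI impI)
  fix \<epsilon> :: real assume "\<epsilon> > 0"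
  then have e: "\<epsilon> / (2 * M) > 0" using M by simp
  obtain d1 where d1: "d1 > 0" "\<And>(I :: nat set) u v. \<lbrakk>finite I; \<And>i. i \<in> I \<Longrightarrow> 0 \<le> u i \<and> u i \<le> v i \<and> v i \<le> 1;
       disjoint_family_on (\<lambda>i. {u i<..<v i}) I; (\<Sum>i\<in>I. v i - u i) < d1\<rbrakk>
     \<Longrightarrow> (\<Sum>i\<in>I. cmod (f (v i) - f (u i))) < \<epsilon> / (2 * M)"
    using AC_01_finite_family[OF f e, where 'i = nat] by blast
  obtain d2 where d2: "d2 > 0" "\<And>(I :: nat set) u v. \<lbrakk>finite I; \<And>i. i \<in> I \<Longrightarrow> 0 \<le> u i \<and> u i \<le> v i \<and> v i \<le> 1;
       disjoint_family_on (\<lambda>i. {u i<..<v i}) I; (\<Sum>i\<in>I. v i - u i) < d2\<rbrakk>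
     \<Longrightarrow> (\<Sum>i\<in>I. cmod (g (v i) - g (u i))) < \<epsilon> / (2 * M)"
    using AC_01_finite_family[OF g e, where 'i = nat] by blast
  show "\<exists>\<delta>>0. \<forall>(n::nat) u v. (\<forall>i<n. 0 \<le> u i \<and> u i \<le> v i \<and> v i \<le> (1::real)) \<longrightarrow>
     disjoint_family_on (\<lambda>i. {u i<..<v i}) {..<n} \<longrightarrow>
     (\<Sum>i<n. v i - u i) < \<delta> \<longrightarrow> (\<Sum>i<n. cmod (h (v i) - h (u i))) < \<epsilon>"
  proof (intro exI[of _ "min d1 d2"] conjI allI impI)
    fix n :: nat and u v :: "nat \<Rightarrow> real"
    assume uv: "\<forall>i<n. 0 \<le> u i \<and> u i \<le> v i \<and> v i \<le> 1"
      and dis: "disjoint_family_on (\<lambda>i. {u i<..<v i}) {..<n}"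
      and less: "(\<Sum>i<n. v i - u i) < min d1 d2"
    have 1: "(\<Sum>i<n. cmod (f (v i) - f (u i))) < \<epsilon> / (2 * M)"
      by (rule d1(2)) (use uv dis less in auto)
    have 2: "(\<Sum>i<n. cmod (g (v i) - g (u i))) < \<epsilon> / (2 * M)"
      by (rule d2(2)) (use uv dis less in auto)
    have "(\<Sum>i<n. cmod (h (v i) - h (u i))) \<le> (\<Sum>i<n. M * (cmod (f (v i) - f (u i)) + cmod (g (v i) - g (u i))))"
      by (rule sum_mono) (use le uv in auto)
    also have "\<dots> = M * ((\<Sum>i<n. cmod (f (v i) - f (u i))) + (\<Sum>i<n. cmod (g (v i) - g (u i))))"
      by (simp add: sum_distrib_left sum.distrib distrib_left)
    also have "\<dots> < M * (\<epsilon> / (2 * M) + \<epsilon> / (2 * M))"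
      using 1 2 M by (intro mult_strict_left_mono) auto
    also have "\<dots> = \<epsilon>" using M by (simp add: field_simps)
    finally show "(\<Sum>i<n. cmod (h (v i) - h (u i))) < \<epsilon>" .
  qed (use d1 d2 in auto)
qed

lemma AC_01_add: "AC_01 f \<Longrightarrow> AC_01 g \<Longrightarrow> AC_01 (\<lambda>x. f x + g x)"
  by (rule AC_01_of_increment_bound[of f g 1]) (auto simp: add_diff_add norm_triangle_ineq)

lemma AC_01_sum: "(\<And>i. i \<in> I \<Longrightarrow> AC_01 (f i)) \<Longrightarrow> AC_01 (\<lambda>x. \<Sum>i\<in>I. f i x)"
  by (induction I rule: infinite_finite_induct) (auto intro: AC_01_const AC_01_add)

lemma AC_01_continuous_on:
  assumes "AC_01 f" shows "continuous_on {0..1} f"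
  unfolding continuous_on_iff
proof (intro ballI allI impI)
  fix x e :: real assume x: "x \<in> {0..1}" and "e > 0"
  then obtain \<delta> where \<delta>: "\<delta> > 0" "\<And>(I :: nat set) u v. \<lbrakk>finite I; \<And>i. i \<in> I \<Longrightarrow> 0 \<le> u i \<and> u i \<le> v i \<and> v i \<le> 1;
       disjoint_family_on (\<lambda>i. {u i<..<v i}) I; (\<Sum>i\<in>I. v i - u i) < \<delta>\<rbrakk>
     \<Longrightarrow> (\<Sum>i\<in>I. cmod (f (v i) - f (u i))) < e"
    using AC_01_finite_family[OF assms, where 'i = nat] by blast
  have *: "cmod (f v - f u) < e" if "0 \<le> u" "u \<le> v" "v \<le> 1" "v - u < \<delta>" for u v
    using \<delta>(2)[of "{0}" "\<lambda>_. u" "\<lambda>_. v"] that by (auto simp: disjoint_family_on_def)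
  show "\<exists>d>0. \<forall>x'\<in>{0..1}. dist x' x < d \<longrightarrow> dist (f x') (f x) < e"
  proof (intro exI[of _ \<delta>] conjI ballI impI)
    fix y :: real assume y: "y \<in> {0..1}" "dist y x < \<delta>"
    show "dist (f y) (f x) < e"
      using *[of x y] *[of y x] x y by (cases "x \<le> y") (auto simp: dist_norm norm_minus_commute)
  qed (rule \<delta>)
qed

lemma AC_01_mult:
  assumes "AC_01 f" "AC_01 g" shows "AC_01 (\<lambda>x. f x * g x)"
proof -
  have "bounded (f ` {0..1})" "bounded (g ` {0..1})"
    using assms[THEN AC_01_continuous_on] by (auto intro!: compact_imp_bounded compact_continuous_image)
  then obtain A B where AB: "A > 0" "B > 0" "\<And>x. x \<in> {0..1} \<Longrightarrow> cmod (f x) \<le> A" "\<And>x. x \<in> {0..1} \<Longrightarrow> cmod (g x) \<le> B"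
    unfolding bounded_pos by auto
  show ?thesis
  proof (rule AC_01_of_increment_bound[OF assms, of "max A B"])
    fix u v :: real assume uv: "0 \<le> u" "u \<le> v" "v \<le> 1"
    have "f v * g v - f u * g u = (f v - f u) * g v + f u * (g v - g u)" by (simp add: algebra_simps)
    then have "cmod (f v * g v - f u * g u) \<le> cmod (f v - f u) * cmod (g v) + cmod (f u) * cmod (g v - g u)"
      using norm_triangle_ineq[of "(f v - f u) * g v" "f u * (g v - g u)"] by (simp add: norm_mult)
    also have "\<dots> \<le> cmod (f v - f u) * max A B + max A B * cmod (g v - g u)"
      using AB(3)[of u] AB(4)[of v] uv by (intro add_mono mult_left_mono mult_right_mono) auto
    finally show "cmod (f v * g v - f u * g u) \<le> max A B * (cmod (f v - f u) + cmod (g v - g u))"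
      by (simp add: algebra_simps)
  qed (use AB in auto)
qed

lemma AC_01_power: "AC_01 f \<Longrightarrow> AC_01 (\<lambda>x. f x ^ n)"
  by (induction n) (auto intro: AC_01_const AC_01_mult)

text \<open>An integrable function is bounded up to a part of small integral, which is the reason why its integral is
  absolutely continuous.\<close>
lemma truncation_error_small:
  fixes h :: "real \<Rightarrow> real"
  assumes h: "h absolutely_integrable_on {0..1}" and "e > 0"
  obtains k :: nat where "(\<lambda>x. h x - min (h x) (real k)) absolutely_integrable_on {0..1}"
    "(\<lambda>x. min (h x) (real k)) absolutely_integrable_on {0..1}"
    "integral {0..1} (\<lambda>x. h x - min (h x) (real k)) < e"
proof -
  have min: "(\<lambda>x. min (h x) (real k)) absolutely_integrable_on {0..1}" for k
    using absolutely_integrable_min_1[OF h absolutely_integrable_on_const[of "{0..1}" "real k"]] by simp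
  have diff: "(\<lambda>x. h x - min (h x) (real k)) absolutely_integrable_on {0..1}" for k
    by (rule set_integral_diff(1)[OF h min])
  have lim: "(\<lambda>k. h x - min (h x) (real k)) \<longlonglongrightarrow> 0" for x
  proof (rule tendsto_eventually)
    obtain n where "h x \<le> real n" using real_arch_simple by blast
    then show "\<forall>\<^sub>F k in sequentially. h x - min (h x) (real k) = 0"
      by (intro eventually_sequentiallyI[of n]) auto
  qed
  have "(\<lambda>k. integral {0..1} (\<lambda>x. h x - min (h x) (real k))) \<longlonglongrightarrow> integral {0..1::real} (\<lambda>x. 0)"
  proof (rule Equivalence_Lebesgue_Henstock_Integration.dominated_convergence(2)[where h = "\<lambda>x. \<bar>h x\<bar>"])
    show "(\<lambda>x. \<bar>h x\<bar>) integrable_on {0..1}" using absolutely_integrable_norm[OF h] by (simp add: absolutely_integrable_on_def o_def)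
    show "norm (h x - min (h x) (real k)) \<le> \<bar>h x\<bar>" for k x by auto
    show "(\<lambda>x. h x - min (h x) (real k)) integrable_on {0..1}" for k
      using diff by (simp add: absolutely_integrable_on_def)
  qed (use lim in auto)
  then have "\<forall>\<^sub>F k in sequentially. integral {0..1} (\<lambda>x. h x - min (h x) (real k)) < e"
    using \<open>e > 0\<close> by (intro order_tendstoD) auto
  then show thesis using that min diff by (auto simp: eventually_sequentially)
qed

lemma sum_integrals_le:
  fixes r :: "real \<Rightarrow> real"
  assumes r: "r integrable_on {0..1}" "\<And>x. r x \<ge> 0" and fin: "finite I"
    and uv: "\<And>i. i \<in> I \<Longrightarrow> 0 \<le> u i \<and> u i \<le> v i \<and> v i \<le> 1"
    and dis: "disjoint_family_on (\<lambda>i. {u i<..<v i}) I"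
  shows "(\<Sum>i\<in>I. integral {u i..v i} r) \<le> integral {0..1} r"
proof -
  have hi: "(r has_integral integral {u i..v i} r) {u i<..<v i}" if "i \<in> I" for i
  proof -
    have "r integrable_on {u i..v i}" by (rule integrable_subinterval_real[OF r(1)]) (use uv[OF that] in auto)
    then have "(r has_integral integral {u i..v i} r) {u i..v i}" by (rule integrable_integral)
    then show ?thesis by (simp add: has_integral_Icc_iff_Ioo)
  qed
  have "(r has_integral (\<Sum>i\<in>I. integral {u i..v i} r)) (\<Union>i\<in>I. {u i<..<v i})"
    by (rule has_integral_UN[OF fin hi])
       (use dis in \<open>auto simp: pairwise_def disjoint_family_on_def\<close>)
  then have "(\<Sum>i\<in>I. integral {u i..v i} r) = integral (\<Union>i\<in>I. {u i<..<v i}) r"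
    and "r integrable_on (\<Union>i\<in>I. {u i<..<v i})"
    by (auto simp: integral_unique has_integral_integrable)
  moreover have "(\<Union>i\<in>I. {u i<..<v i}) \<subseteq> {0..1}" using uv by fastforce
  ultimately show ?thesis using r integral_subset_le[of "\<Union>i\<in>I. {u i<..<v i}" "{0..1}" r] by simp
qed

lemma integral_increment:
  fixes g :: "real \<Rightarrow> 'a::banach"
  assumes "g integrable_on {0..1}" "0 \<le> u" "u \<le> v" "v \<le> 1"
  shows "integral {0..v} g - integral {0..u} g = integral {u..v} g"
proof -
  have "g integrable_on {0..v}" by (rule integrable_subinterval_real[OF assms(1)]) (use assms in auto)
  then have "integral {0..u} g + integral {u..v} g = integral {0..v} g"
    using assms by (intro Henstock_Kurzweil_Integration.integral_combine) auto
  then show ?thesis by (metis add_diff_cancel_left')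
qed

text \<open>Split \<open>|g|\<close> into a part bounded by \<open>k\<close>, whose integral over small sets is small, and a remainder
  \<open>r\<close>, whose integral is small over all of \<open>[0,1]\<close>.\<close>
lemma AC_01_indefinite_integral:
  assumes g: "g absolutely_integrable_on {0..1}"
  shows "AC_01 (\<lambda>x. integral {0..x} g)"
  unfolding AC_01_def
proof (intro allI impI)
  fix e :: real assume "e > 0"
  define h where "h = (\<lambda>x. cmod (g x))"
  have h: "h absolutely_integrable_on {0..1}" unfolding h_def using absolutely_integrable_norm[OF g] by (simp add: o_def)
  obtain k where k: "(\<lambda>x. h x - min (h x) (real k)) absolutely_integrable_on {0..1}"
    "(\<lambda>x. min (h x) (real k)) absolutely_integrable_on {0..1}"
    "integral {0..1} (\<lambda>x. h x - min (h x) (real k)) < e/2"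
    using truncation_error_small[OF h, of "e/2"] \<open>e > 0\<close> by auto
  define r where "r = (\<lambda>x. h x - min (h x) (real k))"
  have rint: "r integrable_on {0..1}" and mint: "(\<lambda>x. min (h x) (real k)) integrable_on {0..1}"
    and gint: "g integrable_on {0..1}" and hint: "h integrable_on {0..1}"
    using k g h by (auto simp: absolutely_integrable_on_def r_def)
  have le: "cmod (integral {0..v} g - integral {0..u} g) \<le> integral {u..v} r + k * (v - u)"
    if uv: "0 \<le> u" "u \<le> v" "v \<le> 1" for u v :: real
  proof -
    have sub: "{u..v} \<subseteq> {0..1}" using uv by auto
    note ints = integrable_subinterval_real[OF gint sub] integrable_subinterval_real[OF hint sub]
      integrable_subinterval_real[OF rint sub] integrable_subinterval_real[OF mint sub]
    have "cmod (integral {u..v} g) \<le> integral {u..v} h"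
      by (rule integral_norm_bound_integral) (use ints in \<open>auto simp: h_def\<close>)
    also have "\<dots> = integral {u..v} (\<lambda>x. r x + min (h x) (real k))" by (simp add: r_def)
    also have "\<dots> = integral {u..v} r + integral {u..v} (\<lambda>x. min (h x) (real k))"
      using ints by (intro Henstock_Kurzweil_Integration.integral_add) auto
    also have "integral {u..v} (\<lambda>x. min (h x) (real k)) \<le> integral {u..v} (\<lambda>x. real k)"
      using ints by (intro integral_le) auto
    also have "\<dots> = k * (v - u)" using uv by simp
    finally show ?thesis using integral_increment[OF gint uv] by simp
  qed
  show "\<exists>\<delta>>0. \<forall>(n::nat) u v. (\<forall>i<n. 0 \<le> u i \<and> u i \<le> v i \<and> v i \<le> (1::real)) \<longrightarrow>
     disjoint_family_on (\<lambda>i. {u i<..<v i}) {..<n} \<longrightarrow>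
     (\<Sum>i<n. v i - u i) < \<delta> \<longrightarrow> (\<Sum>i<n. cmod (integral {0..v i} g - integral {0..u i} g)) < e"
  proof (intro exI[of _ "e / (2 * (real k + 1))"] conjI allI impI)
    fix n :: nat and u v :: "nat \<Rightarrow> real"
    assume uv: "\<forall>i<n. 0 \<le> u i \<and> u i \<le> v i \<and> v i \<le> 1"
      and dis: "disjoint_family_on (\<lambda>i. {u i<..<v i}) {..<n}"
      and less: "(\<Sum>i<n. v i - u i) < e / (2 * (real k + 1))"
    have "(\<Sum>i<n. cmod (integral {0..v i} g - integral {0..u i} g)) \<le> (\<Sum>i<n. integral {u i..v i} r + k * (v i - u i))"
      by (rule sum_mono) (use le uv in auto)
    also have "\<dots> = (\<Sum>i<n. integral {u i..v i} r) + k * (\<Sum>i<n. v i - u i)"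
      by (simp add: sum_distrib_left sum.distrib)
    also have "(\<Sum>i<n. integral {u i..v i} r) \<le> integral {0..1} r"
      by (rule sum_integrals_le) (use rint uv dis in \<open>auto simp: r_def\<close>)
    also have "integral {0..1} r < e/2" using k(3) by (simp add: r_def)
    also have "k * (\<Sum>i<n. v i - u i) \<le> k * (e / (2 * (real k + 1)))"
      using less by (intro mult_left_mono) auto
    also have "\<dots> \<le> e/2" using \<open>e > 0\<close> by (simp add: field_simps)
    finally show "(\<Sum>i<n. cmod (integral {0..v i} g - integral {0..u i} g)) < e" by simp
  qed (use \<open>e > 0\<close> in auto)
qed

section \<open>Linear systems with integrable coefficients\<close>

text \<open>Coordinates are indexed by \<open>{..<n}\<close> and vectors are functions on \<open>nat\<close>, in keeping with the numbering of
  quasi-derivatives.\<close>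
locale integrable_system =
  fixes n :: nat and A :: "nat \<Rightarrow> nat \<Rightarrow> real \<Rightarrow> complex"
  assumes coeff: "\<And>i j. i < n \<Longrightarrow> j < n \<Longrightarrow> A i j absolutely_integrable_on {0..1}"
begin

definition rhs :: "(nat \<Rightarrow> real \<Rightarrow> complex) \<Rightarrow> nat \<Rightarrow> real \<Rightarrow> complex" where
  "rhs u i t = (\<Sum>j<n. A i j t * u j t)"

definition weight :: "real \<Rightarrow> real" where
  "weight t = (\<Sum>i<n. \<Sum>j<n. cmod (A i j t))"

definition mass :: "real \<Rightarrow> real" where
  "mass x = integral {0..x} weight"

text \<open>Solutions in the sense of Caratheodory: absolutely continuous, with the equation holding almost everywhere.\<close>
definition solves :: "(nat \<Rightarrow> real \<Rightarrow> complex) \<Rightarrow> bool" where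
  "solves Y \<longleftrightarrow> (\<forall>i<n. AC_01 (Y i)) \<and>
     (\<exists>N. negligible N \<and> (\<forall>i<n. \<forall>x\<in>{0<..<1} - N. (Y i has_vector_derivative rhs Y i x) (at x)))"

lemma rhs_cong: "(\<And>j. j < n \<Longrightarrow> u j t = v j t) \<Longrightarrow> rhs u i t = rhs v i t"
  by (simp add: rhs_def)

lemma rhs_absolutely_integrable:
  assumes u: "\<And>j. j < n \<Longrightarrow> continuous_on {0..1} (u j)" and i: "i < n"
  shows "rhs u i absolutely_integrable_on {0..1}"
proof -
  have "(\<lambda>t. u j t * A i j t) absolutely_integrable_on {0..1}" if j: "j < n" for j
  proof (rule absolutely_integrable_bounded_measurable_product[where h = "(*)", OF _ _ _ _ coeff[OF i j]])
    show "bilinear ((*) :: complex \<Rightarrow> complex \<Rightarrow> complex)" by (simp add: bilinear_conv_bounded_bilinear bounded_bilinear_mult)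
    show "u j \<in> borel_measurable (lebesgue_on {0..1})"
      by (rule continuous_imp_measurable_on_sets_lebesgue[OF u[OF j]]) simp
    show "bounded (u j ` {0..1})"
      by (intro compact_imp_bounded compact_continuous_image u[OF j]) simp
  qed simp
  then have "(\<lambda>t. \<Sum>j<n. u j t * A i j t) absolutely_integrable_on {0..1}"
    by (intro absolutely_integrable_sum) auto
  then show ?thesis by (simp add: rhs_def[abs_def] mult.commute)
qed

lemma weight_absolutely_integrable: "weight absolutely_integrable_on {0..1}"
  unfolding weight_def[abs_def]
  using coeff[THEN absolutely_integrable_norm] by (intro absolutely_integrable_sum) (auto simp: o_def)

lemma weight_nonneg: "weight t \<ge> 0"
  by (simp add: weight_def sum_nonneg)

lemma weight_integrable:
  assumes "x \<le> 1" shows "weight integrable_on {0..x}"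
proof -
  have "weight integrable_on {0..1}" using weight_absolutely_integrable by (simp add: absolutely_integrable_on_def)
  then show ?thesis by (rule integrable_subinterval_real) (use assms in auto)
qed

lemma mass_nonneg: "x \<le> 1 \<Longrightarrow> mass x \<ge> 0"
  unfolding mass_def by (intro integral_nonneg weight_integrable) (auto simp: weight_nonneg)

lemma mass_le_total: "x \<le> 1 \<Longrightarrow> mass x \<le> mass 1"
  unfolding mass_def by (intro integral_subset_le weight_integrable) (auto simp: weight_nonneg)

lemma norm_rhs_le:
  assumes "i < n" "\<And>j. j < n \<Longrightarrow> cmod (u j t) \<le> B" "B \<ge> 0"
  shows "cmod (rhs u i t) \<le> weight t * B"
proof -
  have "cmod (rhs u i t) \<le> (\<Sum>j<n. cmod (A i j t) * B)"
    unfolding rhs_def by (intro sum_norm_le) (use assms in \<open>auto simp: norm_mult intro!: mult_left_mono\<close>)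
  also have "\<dots> = (\<Sum>j<n. cmod (A i j t)) * B" by (simp add: sum_distrib_right)
  also have "(\<Sum>j<n. cmod (A i j t)) \<le> weight t"
    unfolding weight_def by (rule member_le_sum) (use assms in \<open>auto intro: sum_nonneg\<close>)
  finally show ?thesis using assms(3) by (simp add: mult_right_mono)
qed

text \<open>The antiderivative is the obvious one, but \<open>mass\<close> is only absolutely continuous, so the fundamental theorem has to be
  the one for \<open>AC_01\<close>. As \<open>AC_01\<close> is about complex functions, the computation passes through the complex numbers.\<close>
lemma weight_times_mass_power_has_integral:
  assumes x: "x \<in> {0..1}"
  shows "((\<lambda>t. weight t * mass t ^ k) has_integral mass x ^ Suc k / real (Suc k)) {0..x}"
proof -
  define w where "w = (\<lambda>t. complex_of_real (weight t))"
  define W where "W = (\<lambda>x. integral {0..x} w)"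
  have w: "w absolutely_integrable_on {0..1}"
    unfolding w_def using absolutely_integrable_linear[OF weight_absolutely_integrable bounded_linear_of_real]
    by (simp add: o_def)
  have W: "W y = of_real (mass y)" if "y \<in> {0..1}" for y
  proof -
    have "(weight has_integral mass y) {0..y}"
      unfolding mass_def by (rule integrable_integral[OF weight_integrable]) (use that in auto)
    then have "(w has_integral of_real (mass y)) {0..y}"
      using has_integral_linear[OF _ bounded_linear_of_real] by (force simp: w_def o_def)
    then show ?thesis by (simp add: W_def integral_unique)
  qed
  have AC: "AC_01 (\<lambda>x. W x ^ Suc k)"
    unfolding W_def by (intro AC_01_power AC_01_indefinite_integral w)
  have "w integrable_on {0..1}" using w by (simp add: absolutely_integrable_on_def)
  then obtain N where N: "negligible N" and der: "\<And>x. x \<in> {0<..<1} - N \<Longrightarrow> (W has_vector_derivative w x) (at x)"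
    unfolding W_def using Lebesgue_differentiation by blast
  have "((\<lambda>t. of_nat (Suc k) * (W t ^ k * w t)) has_integral W x ^ Suc k - W 0 ^ Suc k) {0..x}"
  proof (rule AC_01_has_integral[OF AC N _ x])
    fix t assume t: "t \<in> {0<..<1} - N"
    have "((\<lambda>z. z ^ Suc k) has_field_derivative (of_nat (Suc k) * W t ^ k)) (at (W t))"
      by (auto intro!: derivative_eq_intros simp del: of_nat_Suc power_Suc)
    then have "(((\<lambda>z. z ^ Suc k) \<circ> W) has_vector_derivative (w t * (of_nat (Suc k) * W t ^ k))) (at t)"
      by (rule field_vector_diff_chain_at[OF der[OF t]])
    then show "((\<lambda>x. W x ^ Suc k) has_vector_derivative of_nat (Suc k) * (W t ^ k * w t)) (at t)"
      by (simp add: o_def mult_ac)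
  qed
  moreover have "W 0 = 0" by (simp add: W_def)
  ultimately have "((\<lambda>t. of_nat (Suc k) * (W t ^ k * w t)) has_integral W x ^ Suc k) {0..x}" by simp
  from has_integral_linear[OF this bounded_linear_Re]
  have "((\<lambda>t. Re (of_nat (Suc k) * (W t ^ k * w t))) has_integral Re (W x ^ Suc k)) {0..x}"
    by (simp add: o_def)
  moreover have "Re (W x ^ Suc k) = mass x ^ Suc k"
    unfolding W[OF x] of_real_power[symmetric] by (rule Re_complex_of_real)
  moreover have "Re (of_nat (Suc k) * (W t ^ k * w t)) = real (Suc k) * (weight t * mass t ^ k)" if "t \<in> {0..x}" for t
  proof -
    have "of_nat (Suc k) * (W t ^ k * w t) = complex_of_real (real (Suc k) * (weight t * mass t ^ k))"
      using W[of t] that x by (simp add: w_def)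
    then show ?thesis by (simp only: Re_complex_of_real)
  qed
  ultimately have "((\<lambda>t. real (Suc k) * (weight t * mass t ^ k)) has_integral mass x ^ Suc k) {0..x}"
    using has_integral_cong by (metis (no_types, lifting))
  from has_integral_mult_right[OF this, of "inverse (real (Suc k))"] show ?thesis
    by (simp add: field_simps del: of_nat_Suc)
qed

lemma rhs_integrable:
  assumes "\<And>j. j < n \<Longrightarrow> continuous_on {0..1} (u j)" "i < n" "x \<le> 1"
  shows "rhs u i integrable_on {0..x}"
proof -
  have "rhs u i integrable_on {0..1}"
    using rhs_absolutely_integrable[OF assms(1,2)] by (simp add: absolutely_integrable_on_def)
  then show ?thesis by (rule integrable_subinterval_real) (use assms in auto)
qed

text \<open>With \<open>mass\<close> in place of \<open>x\<close> the classical estimate survives for coefficients that are merely integrable. It gives both the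
  convergence of the Picard series and uniqueness.\<close>
lemma Picard_step_bound:
  assumes u: "\<And>j. j < n \<Longrightarrow> continuous_on {0..1} (u j)" and K: "K \<ge> 0"
    and le: "\<And>j t. \<lbrakk>j < n; t \<in> {0..1}\<rbrakk> \<Longrightarrow> cmod (u j t) \<le> K * mass t ^ k / fact k"
    and i: "i < n" and x: "x \<in> {0..1}"
  shows "cmod (integral {0..x} (rhs u i)) \<le> K * mass x ^ Suc k / fact (Suc k)"
proof -
  have hi: "((\<lambda>t. K / fact k * (weight t * mass t ^ k)) has_integral K / fact k * (mass x ^ Suc k / real (Suc k))) {0..x}"
    by (rule has_integral_mult_right[OF weight_times_mass_power_has_integral[OF x]])
  have "cmod (integral {0..x} (rhs u i)) \<le> integral {0..x} (\<lambda>t. K / fact k * (weight t * mass t ^ k))"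
  proof (rule integral_norm_bound_integral)
    show "rhs u i integrable_on {0..x}" by (rule rhs_integrable[OF u i]) (use x in auto)
    show "(\<lambda>t. K / fact k * (weight t * mass t ^ k)) integrable_on {0..x}" using hi by (rule has_integral_integrable)
    fix t assume "t \<in> {0..x}"
    then have t: "t \<in> {0..1}" using x by auto
    then have "0 \<le> K * mass t ^ k / fact k" using K mass_nonneg[of t] by simp
    then show "cmod (rhs u i t) \<le> K / fact k * (weight t * mass t ^ k)"
      using norm_rhs_le[OF i le] t by (simp add: mult_ac)
  qed
  also have "\<dots> = K / fact k * (mass x ^ Suc k / real (Suc k))" using hi by (rule integral_unique)
  also have "\<dots> = K * mass x ^ Suc k / fact (Suc k)" by (simp add: field_simps)
  finally show ?thesis .
qed

lemma integral_rhs_continuous: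
  assumes u: "\<And>j. j < n \<Longrightarrow> continuous_on {0..1} (u j)" and i: "i < n"
  shows "continuous_on {0..1} (\<lambda>x. integral {0..x} (rhs u i))"
  by (intro AC_01_continuous_on AC_01_indefinite_integral rhs_absolutely_integrable assms)

lemma solves_integral_equation:
  assumes "solves Y" "i < n" "x \<in> {0..1}"
  shows "Y i x = Y i 0 + integral {0..x} (rhs Y i)"
proof -
  obtain N where "negligible N" "\<And>x. x \<in> {0<..<1} - N \<Longrightarrow> (Y i has_vector_derivative rhs Y i x) (at x)"
    using assms unfolding solves_def by blast
  moreover have "AC_01 (Y i)" using assms by (simp add: solves_def)
  ultimately have "(rhs Y i has_integral Y i x - Y i 0) {0..x}"
    using AC_01_has_integral assms(3) by blast
  then show ?thesis by (simp add: integral_unique)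
qed

lemma factorial_bound_tendsto_0: "(\<lambda>k. K * a ^ k / fact k :: real) \<longlonglongrightarrow> 0"
proof -
  have "summable (\<lambda>k. inverse (fact k) * a ^ k)" by (rule summable_exp)
  then have "(\<lambda>k. K * (inverse (fact k) * a ^ k)) \<longlonglongrightarrow> K * 0"
    by (intro tendsto_mult tendsto_const summable_LIMSEQ_zero)
  then show ?thesis by (simp add: field_simps)
qed

text \<open>A solution with zero initial values is a fixed point of the Picard step. Iterating the step bounds it by
  \<open>K mass(x)\<^sup>k / k!\<close> for every \<open>k\<close>.\<close>
theorem solves_unique:
  assumes Y: "solves Y" and init: "\<And>i. i < n \<Longrightarrow> Y i 0 = 0" and i: "i < n" and x: "x \<in> {0..1}"
  shows "Y i x = 0"
proof -
  have cont: "continuous_on {0..1} (Y j)" if "j < n" for j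
    using Y that by (auto simp: solves_def AC_01_continuous_on)
  have eq: "Y j t = integral {0..t} (rhs Y j)" if "j < n" "t \<in> {0..1}" for j t
    using solves_integral_equation[OF Y that] init[OF that(1)] by simp
  have "bounded (\<Union>j\<in>{..<n}. Y j ` {0..1})"
    by (intro bounded_UN ballI compact_imp_bounded compact_continuous_image cont) auto
  then obtain K where K: "K > 0" "\<And>j t. \<lbrakk>j < n; t \<in> {0..1}\<rbrakk> \<Longrightarrow> cmod (Y j t) \<le> K"
    unfolding bounded_pos by (auto 4 4)
  have "\<forall>j<n. \<forall>t\<in>{0..1}. cmod (Y j t) \<le> K * mass t ^ k / fact k" for k
  proof (induction k)
    case 0 then show ?case using K by simp
  next
    case (Suc k)
    then show ?case using Picard_step_bound[of Y K k] cont K(1) eq by auto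
  qed
  then have "cmod (Y i x) \<le> K * mass x ^ k / fact k" for k using i x by blast
  then have "cmod (Y i x) \<le> 0"
    by (intro LIMSEQ_le_const[OF factorial_bound_tendsto_0]) auto
  then show ?thesis by simp
qed

text \<open>These are the increments of Picard's iteration; the solution is their sum.\<close>
primrec Picard :: "(nat \<Rightarrow> complex) \<Rightarrow> nat \<Rightarrow> nat \<Rightarrow> real \<Rightarrow> complex" where
  "Picard c 0 = (\<lambda>i x. c i)"
| "Picard c (Suc k) = (\<lambda>i x. integral {0..x} (rhs (Picard c k) i))"

lemma Picard_continuous: "i < n \<Longrightarrow> continuous_on {0..1} (Picard c k i)"
proof (induction k arbitrary: i)
  case (Suc k)
  then show ?case using integral_rhs_continuous[of "Picard c k" i] by simp
qed simp

lemma Picard_bound: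
  "i < n \<Longrightarrow> x \<in> {0..1} \<Longrightarrow> cmod (Picard c k i x) \<le> (\<Sum>j<n. cmod (c j)) * mass x ^ k / fact k"
proof (induction k arbitrary: i x)
  case 0
  then show ?case by (auto intro!: member_le_sum)
next
  case (Suc k)
  show ?case unfolding Picard.simps
    by (rule Picard_step_bound) (use Suc Picard_continuous in \<open>auto intro: sum_nonneg\<close>)
qed

lemma rhs_diff: "rhs (\<lambda>j t. u j t - v j t) i t = rhs u i t - rhs v i t"
  by (simp add: rhs_def algebra_simps sum_subtractf)

lemma rhs_sum: "rhs (\<lambda>j t. \<Sum>k\<in>I. u k j t) i t = (\<Sum>k\<in>I. rhs (u k) i t)"
  unfolding rhs_def sum_distrib_left by (rule sum.swap)

lemma integral_equation_solvable:
  obtains Y where "\<And>i. i < n \<Longrightarrow> continuous_on {0..1} (Y i)"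
    "\<And>i x. \<lbrakk>i < n; x \<in> {0..1}\<rbrakk> \<Longrightarrow> Y i x = c i + integral {0..x} (rhs Y i)"
proof -
  define S where "S N i x = (\<Sum>k<N. Picard c k i x)" for N i x
  define Y where "Y i x = (\<Sum>k. Picard c k i x)" for i x
  define K where "K = (\<Sum>j<n. cmod (c j))"
  have K: "K \<ge> 0" by (simp add: K_def sum_nonneg)
  have ul: "uniform_limit {0..1} (\<lambda>N. S N i) (Y i) sequentially" if i: "i < n" for i
    unfolding S_def[abs_def] Y_def[abs_def]
  proof (rule Weierstrass_m_test)
    show "summable (\<lambda>k. K * mass 1 ^ k / fact k)"
      using summable_mult[OF summable_exp, of K "mass 1"] by (simp add: field_simps)
    fix k x assume x: "x \<in> {0..1::real}"
    have "cmod (Picard c k i x) \<le> K * mass x ^ k / fact k"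
      using Picard_bound[OF i x] by (simp add: K_def)
    also have "\<dots> \<le> K * mass 1 ^ k / fact k"
      using mass_nonneg[of x] mass_le_total[of x] x K
      by (intro divide_right_mono mult_left_mono power_mono) auto
    finally show "cmod (Picard c k i x) \<le> K * mass 1 ^ k / fact k" .
  qed
  have Scont: "continuous_on {0..1} (S N i)" if "i < n" for N i
    unfolding S_def[abs_def] by (intro continuous_on_sum Picard_continuous that)
  have Ycont: "continuous_on {0..1} (Y i)" if "i < n" for i
    by (rule uniform_limit_theorem[OF _ ul[OF that]]) (use Scont that in auto)
  have lim: "(\<lambda>N. S N i x) \<longlonglongrightarrow> Y i x" if "i < n" "x \<in> {0..1}" for i x
    using tendsto_uniform_limitI[OF ul[OF that(1)] that(2)] .
  have Sint: "integral {0..x} (rhs (S N) i) = S (Suc N) i x - c i" if "i < n" "x \<in> {0..1}" for N i x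
  proof -
    have "integral {0..x} (rhs (S N) i) = (\<Sum>k<N. integral {0..x} (rhs (Picard c k) i))"
      unfolding S_def rhs_sum[abs_def]
      by (rule integral_sum) (use that in \<open>auto intro!: rhs_integrable Picard_continuous\<close>)
    also have "\<dots> = S (Suc N) i x - c i" unfolding S_def sum.lessThan_Suc_shift by simp
    finally show ?thesis .
  qed
  \<comment> \<open>The Picard step estimate with exponent \<open>0\<close> says that integration of \<open>rhs\<close> is continuous for the supremum norm.\<close>
  have Ilim: "(\<lambda>N. integral {0..x} (rhs (S N) i)) \<longlonglongrightarrow> integral {0..x} (rhs Y i)"
    if i: "i < n" and x: "x \<in> {0..1}" for i x
  proof (rule LIMSEQ_I)
    fix e :: real assume "e > 0"
    define e' where "e' = e / (mass x + 1)"
    have m: "mass x \<ge> 0" using mass_nonneg x by simp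
    then have e': "e' > 0" using \<open>e > 0\<close> by (simp add: e'_def)
    have "\<forall>\<^sub>F N in sequentially. \<forall>j\<in>{..<n}. \<forall>t\<in>{0..1}. dist (S N j t) (Y j t) < e'"
      by (intro eventually_ball_finite ballI uniform_limitD[OF ul e']) auto
    then obtain N0 where N0: "\<And>N j t. \<lbrakk>N \<ge> N0; j < n; t \<in> {0..1}\<rbrakk> \<Longrightarrow> cmod (S N j t - Y j t) < e'"
      unfolding eventually_sequentially dist_norm by blast
    show "\<exists>N0. \<forall>N\<ge>N0. norm (integral {0..x} (rhs (S N) i) - integral {0..x} (rhs Y i)) < e"
    proof (intro exI allI impI)
      fix N assume N: "N \<ge> N0"
      have "integral {0..x} (rhs (S N) i) - integral {0..x} (rhs Y i) = integral {0..x} (rhs (\<lambda>j t. S N j t - Y j t) i)"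
        unfolding rhs_diff[abs_def]
        by (rule Henstock_Kurzweil_Integration.integral_diff[symmetric])
           (use i x in \<open>auto intro!: rhs_integrable Scont Ycont\<close>)
      also have "cmod \<dots> \<le> e' * mass x ^ Suc 0 / fact (Suc 0)"
        by (rule Picard_step_bound)
           (use i x e' N0[OF N] in \<open>auto intro!: continuous_on_diff Scont Ycont less_imp_le\<close>)
      also have "\<dots> < e" using m \<open>e > 0\<close> by (simp add: e'_def field_simps)
      finally show "norm (integral {0..x} (rhs (S N) i) - integral {0..x} (rhs Y i)) < e" .
    qed
  qed
  have "Y i x = c i + integral {0..x} (rhs Y i)" if "i < n" "x \<in> {0..1}" for i x
  proof -
    have "(\<lambda>N. S (Suc N) i x - c i) \<longlonglongrightarrow> Y i x - c i"
      by (intro tendsto_intros LIMSEQ_Suc lim that)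
    moreover have "(\<lambda>N. S (Suc N) i x - c i) \<longlonglongrightarrow> integral {0..x} (rhs Y i)"
      using Ilim[OF that] Sint[OF that] by simp
    ultimately have "Y i x - c i = integral {0..x} (rhs Y i)" by (rule LIMSEQ_unique)
    then show ?thesis by (simp add: algebra_simps)
  qed
  with Ycont show thesis using that by blast
qed

theorem initial_value_problem_solvable:
  obtains Y where "solves Y" "\<And>i. i < n \<Longrightarrow> Y i 0 = c i"
proof -
  obtain Z where Zc: "\<And>i. i < n \<Longrightarrow> continuous_on {0..1} (Z i)"
    and Z: "\<And>i x. \<lbrakk>i < n; x \<in> {0..1}\<rbrakk> \<Longrightarrow> Z i x = c i + integral {0..x} (rhs Z i)"
    using integral_equation_solvable[of c] by blast
  \<comment> \<open>\<open>Y\<close> agrees with \<open>Z\<close> on \<open>[0,1]\<close>; being an explicit indefinite integral, it is absolutely continuous and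
    differentiable almost everywhere by the general results.\<close>
  define Y where "Y i x = c i + integral {0..x} (rhs Z i)" for i x
  have rhs: "rhs Y i x = rhs Z i x" if "x \<in> {0..1}" for i x
    by (rule rhs_cong) (use Z that in \<open>simp add: Y_def\<close>)
  have AC: "AC_01 (Y i)" if "i < n" for i
    unfolding Y_def[abs_def]
    by (intro AC_01_add AC_01_const AC_01_indefinite_integral rhs_absolutely_integrable Zc that)
  have "\<exists>N. negligible N \<and> (\<forall>x\<in>{0<..<1} - N. (Y i has_vector_derivative rhs Y i x) (at x))" if i: "i < n" for i
  proof -
    have "rhs Z i integrable_on {0..1}" by (rule rhs_integrable[OF Zc i]) auto
    then obtain N where N: "negligible N"
      and der: "\<And>x. x \<in> {0<..<1} - N \<Longrightarrow> ((\<lambda>x. integral {0..x} (rhs Z i)) has_vector_derivative rhs Z i x) (at x)"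
      using Lebesgue_differentiation by blast
    have "(Y i has_vector_derivative rhs Y i x) (at x)" if "x \<in> {0<..<1} - N" for x
      using has_vector_derivative_add[OF has_vector_derivative_const der[OF that], of "c i"] rhs[of x] that
      by (simp add: Y_def[abs_def])
    then show ?thesis using N by blast
  qed
  then obtain N where N: "\<And>i. i < n \<Longrightarrow> negligible (N i)"
    "\<And>i x. \<lbrakk>i < n; x \<in> {0<..<1} - N i\<rbrakk> \<Longrightarrow> (Y i has_vector_derivative rhs Y i x) (at x)"
    by metis
  have "solves Y"
    unfolding solves_def
  proof (intro conjI exI)
    show "negligible (\<Union>i\<in>{..<n}. N i)" by (intro negligible_Union) (use N in auto)
  qed (use AC N in auto)
  moreover have "Y i 0 = c i" for i by (simp add: Y_def)
  ultimately show thesis using that by blast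
qed

lemma solves_linear_combination:
  assumes fin: "finite I" and Y: "\<And>k. k \<in> I \<Longrightarrow> solves (Y k)"
  shows "solves (\<lambda>i x. \<Sum>k\<in>I. a k * Y k i x)"
proof -
  obtain N where N: "\<And>k. k \<in> I \<Longrightarrow> negligible (N k)"
    "\<And>k i x. \<lbrakk>k \<in> I; i < n; x \<in> {0<..<1} - N k\<rbrakk> \<Longrightarrow> (Y k i has_vector_derivative rhs (Y k) i x) (at x)"
    using Y unfolding solves_def by metis
  show ?thesis
    unfolding solves_def
  proof (intro conjI exI allI impI ballI)
    show "AC_01 (\<lambda>x. \<Sum>k\<in>I. a k * Y k i x)" if "i < n" for i
      by (intro AC_01_sum AC_01_mult AC_01_const) (use Y that in \<open>auto simp: solves_def\<close>)
    show "negligible (\<Union>k\<in>I. N k)" by (intro negligible_Union) (use N fin in auto)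
    fix i x assume ix: "i < n" "x \<in> {0<..<1} - (\<Union>k\<in>I. N k)"
    have "rhs (\<lambda>j t. \<Sum>k\<in>I. a k * Y k j t) i x = (\<Sum>k\<in>I. a k * rhs (Y k) i x)"
      unfolding rhs_sum[of "\<lambda>k j t. a k * Y k j t"] by (simp add: rhs_def sum_distrib_left mult_ac)
    moreover have "((\<lambda>x. \<Sum>k\<in>I. a k * Y k i x) has_vector_derivative (\<Sum>k\<in>I. a k * rhs (Y k) i x)) (at x)"
      by (intro has_vector_derivative_sum has_vector_derivative_mult_right N(2)) (use ix in auto)
    ultimately show "((\<lambda>x. \<Sum>k\<in>I. a k * Y k i x) has_vector_derivative
        rhs (\<lambda>j t. \<Sum>k\<in>I. a k * Y k j t) i x) (at x)" by simp
  qed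
qed

end

section \<open>The quasi-differential equation as a first-order system\<close>

lemma absolutely_integrable_iff_integrable_lebesgue_on:
  fixes f :: "real \<Rightarrow> complex"
  shows "f absolutely_integrable_on {0..1} \<longleftrightarrow> integrable (lebesgue_on {0<..<1}) f"
  unfolding absolutely_integrable_on_Icc_iff_Ioo by (simp add: integrable_restrict_space set_integrable_def)

lemma L2_01_mult_absolutely_integrable:
  assumes "L2_01 f" "L2_01 g"
  shows "(\<lambda>x. f x * g x) absolutely_integrable_on {0..1}"
  unfolding absolutely_integrable_iff_integrable_lebesgue_on
proof (rule Bochner_Integration.integrable_bound)
  show "integrable (lebesgue_on {0<..<1}) (\<lambda>x. (cmod (f x))\<^sup>2 + (cmod (g x))\<^sup>2)"
    using assms by (auto simp: L2_01_def)
  show "(\<lambda>x. f x * g x) \<in> borel_measurable (lebesgue_on {0<..<1})"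
    using assms by (auto simp: L2_01_def)
  have "cmod (f x * g x) \<le> (cmod (f x))\<^sup>2 + (cmod (g x))\<^sup>2" for x
    using sum_squares_bound[of "cmod (f x)" "cmod (g x)"] mult_nonneg_nonneg[OF norm_ge_zero norm_ge_zero, of "f x" "g x"]
    unfolding norm_mult by linarith
  then show "AE x in lebesgue_on {0<..<1}. norm (f x * g x) \<le> norm ((cmod (f x))\<^sup>2 + (cmod (g x))\<^sup>2)"
    by simp
qed

lemma L2_01_const: "L2_01 (\<lambda>x. c)"
proof -
  have "(\<lambda>x. complex_of_real ((cmod c)\<^sup>2)) absolutely_integrable_on {0..1::real}"
    by (rule absolutely_integrable_on_const) simp
  from this[unfolded absolutely_integrable_iff_integrable_lebesgue_on]
  show ?thesis unfolding L2_01_def complex_of_real_integrable_eq by simp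
qed

lemma L2_01_absolutely_integrable: "L2_01 f \<Longrightarrow> f absolutely_integrable_on {0..1}"
  using L2_01_mult_absolutely_integrable[OF _ L2_01_const, of f 1] by simp

text \<open>This is how continuity recovers the values of a quasi-derivative, end points included, from an equation that holds
  almost everywhere.\<close>
lemma continuous_eq_of_eq_off_negligible:
  fixes f g :: "real \<Rightarrow> complex"
  assumes f: "continuous_on {0..1} f" and g: "continuous_on {0..1} g" and N: "negligible N"
    and eq: "\<And>x. x \<in> {0<..<1} - N \<Longrightarrow> f x = g x" and x: "x \<in> {0..1}"
  shows "f x = g x"
proof (rule ccontr)
  assume "f x \<noteq> g x"
  then have e: "dist (f x) (g x) > 0" by simp
  have "continuous_on {0..1} (\<lambda>x. dist (f x) (g x))" by (intro continuous_intros f g)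
  then have "\<exists>d>0. \<forall>y\<in>{0..1}. dist y x < d \<longrightarrow> dist (dist (f y) (g y)) (dist (f x) (g x)) < dist (f x) (g x)"
    using e x unfolding continuous_on_iff by simp
  then obtain d where d: "d > 0" and D: "\<And>y. \<lbrakk>y \<in> {0..1}; dist y x < d\<rbrakk> \<Longrightarrow>
      dist (dist (f y) (g y)) (dist (f x) (g x)) < dist (f x) (g x)"
    by blast
  have sub: "{max 0 (x - d)<..<min 1 (x + d)} \<subseteq> N"
  proof
    fix y assume y: "y \<in> {max 0 (x - d)<..<min 1 (x + d)}"
    then have "dist (dist (f y) (g y)) (dist (f x) (g x)) < dist (f x) (g x)"
      using x by (intro D) (auto simp: dist_real_def)
    then have "f y \<noteq> g y" by auto
    then show "y \<in> N" using y eq by auto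
  qed
  have "{max 0 (x - d)<..<min 1 (x + d)} \<noteq> {}"
    using x d by (auto simp: greaterThanLessThan_empty_iff)
  then show False using open_not_negligible[OF open_greaterThanLessThan] negligible_subset[OF N sub] by blast
qed

locale quasi_differential_expression =
  fixes \<tau>1 \<tau>2 :: "real \<Rightarrow> complex"
  assumes \<tau>1: "L2_01 \<tau>1" and \<tau>2: "L2_01 \<tau>2"
begin

text \<open>The superdiagonal entries \<open>1\<close> of \<open>F_mat\<close> already express \<open>Y\<^sub>k' = Y\<^sub>k\<^sub>+\<^sub>1 + ...\<close>. The entry \<open>\<mu>\<close> in the lower left corner replaces
  \<open>y\<^sup>[\<^sup>4\<^sup>]\<close> by \<open>\<mu> y\<close>. Indices here start from 0.\<close>
definition coef :: "complex \<Rightarrow> nat \<Rightarrow> nat \<Rightarrow> real \<Rightarrow> complex" where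
  "coef \<mu> k j x = F_mat \<tau>1 \<tau>2 (Suc k) (Suc j) x + (if k = 3 \<and> j = 0 then \<mu> else 0)"

lemma less_4_cases: "k < (4::nat) \<Longrightarrow> k = 0 \<or> k = 1 \<or> k = 2 \<or> k = 3"
  by auto

lemma F_mat_absolutely_integrable:
  assumes "k < 4" "j < 4"
  shows "F_mat \<tau>1 \<tau>2 (Suc k) (Suc j) absolutely_integrable_on {0..1}"
proof -
  note ai = L2_01_absolutely_integrable[OF \<tau>1] L2_01_absolutely_integrable[OF \<tau>2]
    L2_01_mult_absolutely_integrable[OF \<tau>1 \<tau>2] L2_01_mult_absolutely_integrable[OF \<tau>2 \<tau>2]
  have neg: "(\<lambda>x. - f x) absolutely_integrable_on {0..1}"
    if "f absolutely_integrable_on {0..1}" for f :: "real \<Rightarrow> complex"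
    using absolutely_integrable_scaleR_left[OF that, of "-1"] by simp
  have "(\<lambda>x. - (\<tau>1 x * \<tau>1 x) + (\<tau>2 x + \<tau>2 x)) absolutely_integrable_on {0..1}"
    by (intro set_integral_add(1) neg L2_01_mult_absolutely_integrable L2_01_absolutely_integrable \<tau>1 \<tau>2)
  then have entry_3_2: "(\<lambda>x. - (\<tau>1 x)\<^sup>2 + 2 * \<tau>2 x) absolutely_integrable_on {0..1}"
    by (simp only: power2_eq_square mult_2)
  have square: "(\<lambda>x. (\<tau>2 x)\<^sup>2) absolutely_integrable_on {0..1}"
    using ai(4) by (simp only: power2_eq_square)
  have const: "(\<lambda>x. c) absolutely_integrable_on {0..1::real}" for c :: complex
    by (rule absolutely_integrable_on_const) simp
  have "(\<lambda>x. F_mat \<tau>1 \<tau>2 (Suc k) (Suc j) x) absolutely_integrable_on {0..1}"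
    using less_4_cases[OF assms(1)] less_4_cases[OF assms(2)]
    unfolding F_mat_def
    by (elim disjE; hypsubst; simp only: nth_Cons_0 nth_Cons_Suc diff_Suc_Suc minus_nat.diff_0 numeral_3_eq_3 numeral_2_eq_2 One_nat_def)
       (intro ai ai[THEN neg] entry_3_2[unfolded numeral_2_eq_2] square[unfolded numeral_2_eq_2] const)+
  then show ?thesis by simp
qed

sublocale system: integrable_system 4 "coef \<mu>" for \<mu>
proof
  fix i j :: nat assume "i < 4" "j < 4"
  then show "coef \<mu> i j absolutely_integrable_on {0..1}"
    unfolding coef_def[abs_def]
    by (intro set_integral_add(1) F_mat_absolutely_integrable absolutely_integrable_on_const) auto
qed

lemma system_rhs_eq:
  assumes "k \<in> {1..4}"
  shows "system.rhs \<mu> Y (k - 1) x =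
    (if k = 4 then \<mu> * Y 0 x else Y k x) + (\<Sum>j=1..k. F_mat \<tau>1 \<tau>2 k j x * Y (j - 1) x)"
proof -
  have "k = 1 \<or> k = 2 \<or> k = 3 \<or> k = 4" using assms by auto
  then show ?thesis
    unfolding system.rhs_def coef_def
    by (elim disjE) (simp_all add: F_mat_def eval_nat_numeral algebra_simps)
qed

text \<open>Each quasi-derivative is determined almost everywhere by the preceding ones, and those of order at most 3 then
  everywhere on \<open>[0,1]\<close> by continuity. Only the values of \<open>y\<close> on \<open>[0,1]\<close> matter, which also shows that the
  choice made in \<open>quasi_deriv\<close> is harmless.\<close>
lemma quasi_chain_unique:
  assumes Y: "quasi_chain \<tau>1 \<tau>2 y Y" and Z: "quasi_chain \<tau>1 \<tau>2 z Z"
    and yz: "\<And>x. x \<in> {0..1} \<Longrightarrow> y x = z x"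
  shows "k \<le> 3 \<Longrightarrow> \<forall>x\<in>{0..1}. Y k x = Z k x"
    and "AE x in lebesgue_on {0<..<1}. Y 4 x = Z 4 x"
proof -
  have step: "\<exists>N. negligible N \<and> (\<forall>x\<in>{0<..<1} - N. Y k x = Z k x)"
    if k: "k \<in> {1..4}" and eq: "\<And>j x. \<lbrakk>j < k; x \<in> {0..1}\<rbrakk> \<Longrightarrow> Y j x = Z j x" for k
  proof -
    obtain N where N: "negligible N" "\<And>x. x \<in> {0<..<1} - N \<Longrightarrow>
        Y k x = vector_derivative (Y (k - 1)) (at x) - (\<Sum>j=1..k. F_mat \<tau>1 \<tau>2 k j x * Y (j - 1) x)"
      using Y k unfolding quasi_chain_def AE_01_iff_negligible by blast
    obtain M where M: "negligible M" "\<And>x. x \<in> {0<..<1} - M \<Longrightarrow>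
        Z k x = vector_derivative (Z (k - 1)) (at x) - (\<Sum>j=1..k. F_mat \<tau>1 \<tau>2 k j x * Z (j - 1) x)"
      using Z k unfolding quasi_chain_def AE_01_iff_negligible by blast
    have "Y k x = Z k x" if x: "x \<in> {0<..<1} - (N \<union> M)" for x
    proof -
      have "\<forall>\<^sub>F t in nhds x. t \<in> {0<..<1}"
        by (rule eventually_nhds_in_open) (use x in auto)
      then have "\<forall>\<^sub>F t in nhds x. t \<in> UNIV \<longrightarrow> Y (k - 1) t = Z (k - 1) t"
        by (rule eventually_mono) (use eq[of "k - 1"] k in auto)
      then have "vector_derivative (Y (k - 1)) (at x) = vector_derivative (Z (k - 1)) (at x)"
        by (rule vector_derivative_cong_eq) auto
      moreover have "(\<Sum>j=1..k. F_mat \<tau>1 \<tau>2 k j x * Y (j - 1) x) = (\<Sum>j=1..k. F_mat \<tau>1 \<tau>2 k j x * Z (j - 1) x)"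
        by (rule sum.cong) (use eq x in auto)
      ultimately show ?thesis using N(2)[of x] M(2)[of x] x by simp
    qed
    then show ?thesis using N(1) M(1) by (intro exI[of _ "N \<union> M"]) auto
  qed
  have main: "k \<le> 3 \<Longrightarrow> \<forall>x\<in>{0..1}. Y k x = Z k x" for k
  proof (induction k rule: less_induct)
    case (less k)
    show ?case
    proof (cases "k = 0")
      case True then show ?thesis using Y Z yz by (simp add: quasi_chain_def)
    next
      case False
      then obtain N where "negligible N" "\<And>x. x \<in> {0<..<1} - N \<Longrightarrow> Y k x = Z k x"
        using step[of k] less by auto
      moreover have "continuous_on {0..1} (Y k)" "continuous_on {0..1} (Z k)"
        using Y Z less(2) by (auto simp: quasi_chain_def AC_01_continuous_on)
      ultimately show ?thesis using continuous_eq_of_eq_off_negligible by blast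
    qed
  qed
  then show "k \<le> 3 \<Longrightarrow> \<forall>x\<in>{0..1}. Y k x = Z k x" .
  show "AE x in lebesgue_on {0<..<1}. Y 4 x = Z 4 x"
    unfolding AE_01_iff_negligible using step[of 4] main by simp
qed

lemma quasi_chain_quasi_deriv:
  assumes "y \<in> D_F \<tau>1 \<tau>2" shows "quasi_chain \<tau>1 \<tau>2 y (quasi_deriv \<tau>1 \<tau>2 y)"
  using assms unfolding D_F_def quasi_deriv_def by (simp add: someI_ex)

lemma solution_imp_solves:
  assumes "solution \<tau>1 \<tau>2 \<mu> y"
  shows "system.solves \<mu> (quasi_deriv \<tau>1 \<tau>2 y)"
proof -
  define Y where "Y = quasi_deriv \<tau>1 \<tau>2 y"
  have Y: "quasi_chain \<tau>1 \<tau>2 y Y"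
    using assms quasi_chain_quasi_deriv by (simp add: solution_def Y_def)
  then have "y = Y 0" unfolding quasi_chain_def by metis
  then have "AE x in lebesgue_on {0<..<1}. Y 4 x = \<mu> * Y 0 x"
    using assms by (simp add: solution_def Y_def)
  then obtain M where M: "negligible M" "\<And>x. x \<in> {0<..<1} - M \<Longrightarrow> Y 4 x = \<mu> * Y 0 x"
    unfolding AE_01_iff_negligible by blast
  have "\<forall>k\<in>{1..4}. \<exists>N. negligible N \<and> (\<forall>x\<in>{0<..<1} - N. Y (k - 1) differentiable (at x) \<and>
        Y k x = vector_derivative (Y (k - 1)) (at x) - (\<Sum>j=1..k. F_mat \<tau>1 \<tau>2 k j x * Y (j - 1) x))"
    using Y unfolding quasi_chain_def AE_01_iff_negligible by blast
  from bchoice[OF this] obtain N where N: "\<forall>k\<in>{1..4}. negligible (N k) \<and> (\<forall>x\<in>{0<..<1} - N k.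
        Y (k - 1) differentiable (at x) \<and>
        Y k x = vector_derivative (Y (k - 1)) (at x) - (\<Sum>j=1..k. F_mat \<tau>1 \<tau>2 k j x * Y (j - 1) x))" ..
  then have negN: "negligible (N k)" if "k \<in> {1..4}" for k using that by blast
  have deriv: "Y i differentiable (at x)"
    "Y (Suc i) x = vector_derivative (Y i) (at x) - (\<Sum>j=1..Suc i. F_mat \<tau>1 \<tau>2 (Suc i) j x * Y (j - 1) x)"
    if "Suc i \<in> {1..4}" "x \<in> {0<..<1} - N (Suc i)" for i x
    using bspec[OF conjunct2[OF bspec[OF N that(1)]] that(2)] unfolding diff_Suc_1 by blast+
  have "system.solves \<mu> Y"
    unfolding system.solves_def
  proof (intro conjI exI allI impI ballI)
    show "AC_01 (Y i)" if "i < 4" for i using Y that by (simp add: quasi_chain_def)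
    show "negligible (M \<union> (\<Union>k\<in>{1..4}. N k))" using M(1) negN by (intro negligible_Un negligible_Union) auto
    fix i :: nat and x assume i: "i < 4" and x: "x \<in> {0<..<1} - (M \<union> (\<Union>k\<in>{1..4}. N k))"
    have k: "Suc i \<in> {1..4}" using i by simp
    have x': "x \<in> {0<..<1} - N (Suc i)" "x \<in> {0<..<1} - M" using x k by blast+
    have "(Y i has_vector_derivative vector_derivative (Y i) (at x)) (at x)"
      using deriv(1)[OF k x'(1)] by (simp add: vector_derivative_works)
    moreover have "vector_derivative (Y i) (at x) = system.rhs \<mu> Y i x"
    proof -
      have "vector_derivative (Y i) (at x) = Y (Suc i) x + (\<Sum>j=1..Suc i. F_mat \<tau>1 \<tau>2 (Suc i) j x * Y (j - 1) x)"
        unfolding deriv(2)[OF k x'(1)] by (rule diff_add_cancel[symmetric])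
      also have "\<dots> = system.rhs \<mu> Y i x"
        using system_rhs_eq[OF k, of \<mu> Y x] M(2)[OF x'(2)] unfolding diff_Suc_1
        by (cases "i = 3") (auto simp del: sum.cl_ivl_Suc)
      finally show ?thesis .
    qed
    ultimately show "(Y i has_vector_derivative system.rhs \<mu> Y i x) (at x)" by simp
  qed
  then show ?thesis by (simp add: Y_def)
qed

lemma solves_imp_solution:
  assumes Y: "system.solves \<mu> Y"
  shows "solution \<tau>1 \<tau>2 \<mu> (Y 0)"
    and "\<And>k x. \<lbrakk>k < 4; x \<in> {0..1}\<rbrakk> \<Longrightarrow> quasi_deriv \<tau>1 \<tau>2 (Y 0) k x = Y k x"
proof -
  define Z where "Z = Y(4 := \<lambda>x. \<mu> * Y 0 x)"
  obtain N where N: "negligible N" "\<And>i x. \<lbrakk>i < 4; x \<in> {0<..<1} - N\<rbrakk> \<Longrightarrow>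
      (Y i has_vector_derivative system.rhs \<mu> Y i x) (at x)"
    using Y unfolding system.solves_def by blast
  have Z: "quasi_chain \<tau>1 \<tau>2 (Y 0) Z"
    unfolding quasi_chain_def AE_01_iff_negligible
  proof (intro conjI ballI allI impI exI[of _ N] N(1))
    show "Z 0 = Y 0" by (simp add: Z_def)
    show "AC_01 (Z k)" if "k \<le> 3" for k using Y that by (simp add: system.solves_def Z_def)
    fix k :: nat and x assume k: "k \<in> {1..4}" and x: "x \<in> {0<..<1} - N"
    then have d: "(Z (k - 1) has_vector_derivative system.rhs \<mu> Y (k - 1) x) (at x)"
      using N(2)[of "k - 1" x] by (auto simp: Z_def)
    then show "Z (k - 1) differentiable (at x)" by (auto intro: differentiableI_vector)
    have "(\<Sum>j=1..k. F_mat \<tau>1 \<tau>2 k j x * Y (j - 1) x) = (\<Sum>j=1..k. F_mat \<tau>1 \<tau>2 k j x * Z (j - 1) x)"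
      by (rule sum.cong) (use k in \<open>auto simp: Z_def\<close>)
    then show "Z k x = vector_derivative (Z (k - 1)) (at x) - (\<Sum>j=1..k. F_mat \<tau>1 \<tau>2 k j x * Z (j - 1) x)"
      using vector_derivative_at[OF d] system_rhs_eq[OF k, of \<mu> Y x] by (simp add: Z_def)
  qed
  then have D: "Y 0 \<in> D_F \<tau>1 \<tau>2" by (auto simp: D_F_def)
  note unique = quasi_chain_unique[OF quasi_chain_quasi_deriv[OF D] Z refl]
  show "solution \<tau>1 \<tau>2 \<mu> (Y 0)"
    using D unique(2) by (simp add: solution_def Z_def)
  show "quasi_deriv \<tau>1 \<tau>2 (Y 0) k x = Y k x" if "k < 4" "x \<in> {0..1}" for k x
    using unique(1)[of k] that by (simp add: Z_def)
qed

end

section \<open>Symplectic linear algebra\<close>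

text \<open>The hypothesis provides an explicit left inverse of \<open>M\<close>. It is also a right inverse, which is the conclusion.\<close>
lemma symplectic_transpose:
  fixes M :: "nat \<Rightarrow> nat \<Rightarrow> complex"
  assumes cols: "\<And>k l. \<lbrakk>k < n; l < n\<rbrakk> \<Longrightarrow>
      (\<Sum>i<n. (-1) ^ i * M i k * M (n - 1 - i) l) = (if k + l = n - 1 then (-1) ^ k else 0)"
    and ij: "i < n" "j < n"
  shows "(\<Sum>k<n. (-1) ^ k * M i k * M j (n - 1 - k)) = (if i + j = n - 1 then (-1) ^ i else 0)"
proof -
  define A where "A = Matrix.mat n n (\<lambda>(i, j). M i j)"
  define B where "B = Matrix.mat n n (\<lambda>(i, j). (-1) ^ (i + j) * M (n - 1 - j) (n - 1 - i))"
  have AB: "A \<in> carrier_mat n n" "B \<in> carrier_mat n n" by (auto simp: A_def B_def)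
  have "B * A = 1\<^sub>m n"
  proof (rule eq_matI)
    fix i k assume "i < dim_row (1\<^sub>m n :: complex mat)" "k < dim_col (1\<^sub>m n :: complex mat)"
    then have ik: "i < n" "k < n" by auto
    have "(B * A) $$ (i, k) = (\<Sum>j<n. (-1) ^ (i + j) * M (n - 1 - j) (n - 1 - i) * M j k)"
      using ik by (simp add: A_def B_def scalar_prod_def atLeast0LessThan)
    also have "\<dots> = (-1) ^ i * (\<Sum>j<n. (-1) ^ j * M j k * M (n - 1 - j) (n - 1 - i))"
      by (simp add: sum_distrib_left power_add mult_ac)
    also have "\<dots> = (if i = k then 1 else 0)"
      using ik by (subst cols) (auto simp flip: power_add)
    finally show "(B * A) $$ (i, k) = 1\<^sub>m n $$ (i, k)" using ik by simp
  qed (auto simp: A_def B_def)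
  then have BA: "A * B = 1\<^sub>m n" using mat_mult_left_right_inverse[OF AB(2,1)] by simp
  \<comment> \<open>The entry of the product that contains row \<open>j\<close> of \<open>M\<close> stands in column \<open>n - 1 - j\<close>.\<close>
  define j' where "j' = n - 1 - j"
  have j': "j' < n" "n - 1 - j' = j" using ij by (auto simp: j'_def)
  have "(\<Sum>k<n. (-1) ^ k * M i k * M j (n - 1 - k)) = (-1) ^ j' * (\<Sum>k<n. M i k * ((-1) ^ (k + j') * M (n - 1 - j') (n - 1 - k)))"
    unfolding sum_distrib_left j'(2)
    by (rule sum.cong) (auto simp: power_add mult_ac simp flip: power_mult_distrib)
  also have "(\<Sum>k<n. M i k * ((-1) ^ (k + j') * M (n - 1 - j') (n - 1 - k))) = (A * B) $$ (i, j')"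
    using ij j' by (simp add: A_def B_def scalar_prod_def atLeast0LessThan)
  also have "\<dots> = (if i = j' then 1 else 0)" using ij j' by (simp add: BA)
  also have "(-1) ^ j' * (if i = j' then 1 else 0) = (if i + j = n - 1 then (-1) ^ i else (0::complex))"
    using ij by (auto simp: j'_def)
  finally show ?thesis .
qed

lemma det_mat_2:
  fixes f :: "nat \<times> nat \<Rightarrow> 'a::comm_ring_1"
  shows "Determinant.det (Matrix.mat 2 2 f) = f (0, 0) * f (1, 1) - f (0, 1) * f (1, 0)"
proof -
  let ?A = "Matrix.mat 2 2 f"
  have 1: "Determinant.det B = B $$ (0, 0)" if "B \<in> carrier_mat 1 1" for B :: "'a mat"
    by (rule det_single[OF that])
  have "Determinant.det ?A = (\<Sum>i<2. ?A $$ (i, 0) * cofactor ?A i 0)"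
    by (rule laplace_expansion_column) auto
  also have "\<dots> = f (0, 0) * f (1, 1) - f (0, 1) * f (1, 0)"
    by (simp add: numeral_2_eq_2 cofactor_def 1 mat_delete_def)
  finally show ?thesis .
qed

lemma singular_2x2_kernel:
  fixes p q r s :: complex
  assumes "p * s - q * r = 0"
  obtains a b where "(a, b) \<noteq> (0, 0)" "a * p + b * q = 0" "a * r + b * s = 0"
proof (cases "p = 0 \<and> q = 0")
  case True
  show thesis
  proof (cases "r = 0 \<and> s = 0")
    case True then show thesis using that[of 1 0] \<open>p = 0 \<and> q = 0\<close> by simp
  next
    case False then show thesis using that[of s "- r"] True by (auto simp: mult.commute)
  qed
next
  case False
  then show thesis using that[of q "- p"] assms by (auto simp: algebra_simps)
qed

section \<open>Lagrange's identity and the fundamental system\<close>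

context quasi_differential_expression
begin

text \<open>The derivative of the form vanishes because \<open>coef \<mu>\<close>, multiplied by the antidiagonal matrix with
  alternating signs, is symmetric. This is the formal self-adjointness of \<open>l\<close>; the spectral parameter only
  enters a diagonal entry of that symmetric matrix.\<close>
lemma Lagrange_identity:
  assumes Y: "system.solves \<mu> Y" and Z: "system.solves \<mu> Z" and x: "x \<in> {0..1}"
  defines "w \<equiv> \<lambda>x. \<Sum>i<4. (-1) ^ i * Y i x * Z (3 - i) x"
  shows "w x = w 0"
proof -
  obtain N where N: "negligible N" "\<And>i x. \<lbrakk>i < 4; x \<in> {0<..<1} - N\<rbrakk> \<Longrightarrow> (Y i has_vector_derivative system.rhs \<mu> Y i x) (at x)"
    using Y unfolding system.solves_def by blast
  obtain M where M: "negligible M" "\<And>i x. \<lbrakk>i < 4; x \<in> {0<..<1} - M\<rbrakk> \<Longrightarrow> (Z i has_vector_derivative system.rhs \<mu> Z i x) (at x)"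
    using Z unfolding system.solves_def by blast
  have AC: "AC_01 w"
    unfolding w_def by (intro AC_01_sum AC_01_mult AC_01_const) (use Y Z in \<open>auto simp: system.solves_def\<close>)
  have "(w has_vector_derivative 0) (at t)" if t: "t \<in> {0<..<1} - (N \<union> M)" for t
  proof -
    have "(w has_vector_derivative (\<Sum>i<4. ((-1) ^ i * Y i t) * system.rhs \<mu> Z (3 - i) t
        + ((-1) ^ i * system.rhs \<mu> Y i t) * Z (3 - i) t)) (at t)"
      unfolding w_def
      by (intro has_vector_derivative_sum has_vector_derivative_mult has_vector_derivative_mult_right N(2) M(2))
         (use t in auto)
    moreover have "(\<Sum>i<4. ((-1) ^ i * Y i t) * system.rhs \<mu> Z (3 - i) t
        + ((-1) ^ i * system.rhs \<mu> Y i t) * Z (3 - i) t) = 0"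
      unfolding system.rhs_def coef_def
      by (simp add: F_mat_def eval_nat_numeral algebra_simps)
    ultimately show ?thesis by simp
  qed
  then have "((\<lambda>_. 0) has_integral w x - w 0) {0..x}"
    by (intro AC_01_has_integral[OF AC _ _ x, of "N \<union> M"]) (use N M in auto)
  then have "w x - w 0 = 0" by (rule has_integral_unique) (rule has_integral_0)
  then show ?thesis by simp
qed

lemma C_sol:
  assumes k: "k \<in> {1..4}"
  shows "solution \<tau>1 \<tau>2 \<mu> (C_sol \<tau>1 \<tau>2 k \<mu>)"
    and "\<And>s. s \<in> {1..4} \<Longrightarrow> U_form \<tau>1 \<tau>2 s (C_sol \<tau>1 \<tau>2 k \<mu>) = (if s = k then 1 else 0)"
proof -
  obtain Y where Y: "system.solves \<mu> Y" and init: "\<And>i. i < 4 \<Longrightarrow> Y i 0 = (if i = k - 1 then 1 else 0)"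
    using system.initial_value_problem_solvable[of \<mu> "\<lambda>i. if i = k - 1 then 1 else 0"] by blast
  have "U_form \<tau>1 \<tau>2 s (Y 0) = (if s = k then 1 else 0)" if s: "s \<in> {1..4}" for s
    using solves_imp_solution(2)[OF Y, of "s - 1" 0] init[of "s - 1"] s k by (auto simp: U_form_def)
  then have "\<exists>y. solution \<tau>1 \<tau>2 \<mu> y \<and> (\<forall>s\<in>{1..4}. U_form \<tau>1 \<tau>2 s y = (if s = k then 1 else 0))"
    using solves_imp_solution(1)[OF Y] by blast
  from someI_ex[OF this, folded C_sol_def]
  show "solution \<tau>1 \<tau>2 \<mu> (C_sol \<tau>1 \<tau>2 k \<mu>)"
    and "\<And>s. s \<in> {1..4} \<Longrightarrow> U_form \<tau>1 \<tau>2 s (C_sol \<tau>1 \<tau>2 k \<mu>) = (if s = k then 1 else 0)"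
    by blast+
qed

definition fundamental :: "complex \<Rightarrow> nat \<Rightarrow> nat \<Rightarrow> real \<Rightarrow> complex" where
  "fundamental \<mu> k = quasi_deriv \<tau>1 \<tau>2 (C_sol \<tau>1 \<tau>2 k \<mu>)"

lemma fundamental_solves: "k \<in> {1..4} \<Longrightarrow> system.solves \<mu> (fundamental \<mu> k)"
  unfolding fundamental_def by (intro solution_imp_solves C_sol)

lemma fundamental_initial: "k \<in> {1..4} \<Longrightarrow> i < 4 \<Longrightarrow> fundamental \<mu> k i 0 = (if Suc i = k then 1 else 0)"
  using C_sol(2)[of k "Suc i" \<mu>] by (simp add: fundamental_def U_form_def)

text \<open>The difference of the two sides solves the system and has zero initial values.\<close>
lemma quasi_deriv_expansion:
  assumes y: "solution \<tau>1 \<tau>2 \<mu> y" and i: "i < 4" and x: "x \<in> {0..1}"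
  shows "quasi_deriv \<tau>1 \<tau>2 y i x = (\<Sum>k=1..4. U_form \<tau>1 \<tau>2 k y * fundamental \<mu> k i x)"
proof -
  \<comment> \<open>Index \<open>0\<close> stands for \<open>y\<close> itself, which enters with coefficient \<open>- 1\<close>.\<close>
  define Z where "Z k = (if k = 0 then quasi_deriv \<tau>1 \<tau>2 y else fundamental \<mu> k)" for k
  define a where "a k = (if k = 0 then - 1 else U_form \<tau>1 \<tau>2 k y)" for k
  define D where "D i x = (\<Sum>k\<in>insert 0 {1..4}. a k * Z k i x)" for i x
  have D: "D i x = (\<Sum>k=1..4. U_form \<tau>1 \<tau>2 k y * fundamental \<mu> k i x) - quasi_deriv \<tau>1 \<tau>2 y i x" for i x
  proof -
    have "(\<Sum>k\<in>{1..4}. a k * Z k i x) = (\<Sum>k=1..4. U_form \<tau>1 \<tau>2 k y * fundamental \<mu> k i x)"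
      by (rule sum.cong) (auto simp: a_def Z_def)
    then show ?thesis unfolding D_def by (subst sum.insert) (auto simp: a_def Z_def)
  qed
  have "system.solves \<mu> D"
    unfolding D_def[abs_def]
    by (rule system.solves_linear_combination)
       (use fundamental_solves[of _ \<mu>] solution_imp_solves[OF y] in \<open>auto simp: Z_def\<close>)
  moreover have "D j 0 = 0" if j: "j < 4" for j
  proof -
    have "(\<Sum>k=1..4. U_form \<tau>1 \<tau>2 k y * fundamental \<mu> k j 0) = (\<Sum>k=1..4. if k = Suc j then U_form \<tau>1 \<tau>2 k y else 0)"
      by (rule sum.cong) (use j in \<open>auto simp: fundamental_initial\<close>)
    also have "\<dots> = U_form \<tau>1 \<tau>2 (Suc j) y" using j by simp
    finally show ?thesis unfolding D by (simp add: U_form_def)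
  qed
  ultimately have "D i x = 0" using system.solves_unique i x by blast
  then show ?thesis unfolding D by simp
qed

lemma combination_of_two_solves:
  assumes "k \<in> {1..4}" "l \<in> {1..4}"
  shows "system.solves \<mu> (\<lambda>i x. a * fundamental \<mu> k i x + b * fundamental \<mu> l i x)"
proof -
  have "system.solves \<mu> (\<lambda>i x. \<Sum>m\<in>{True, False}. (if m then a else b) * (if m then fundamental \<mu> k else fundamental \<mu> l) i x)"
    by (rule system.solves_linear_combination) (use assms fundamental_solves in auto)
  then show ?thesis by simp
qed

lemma quasi_deriv_eq_0:
  assumes "y \<in> D_F \<tau>1 \<tau>2" and zero: "\<And>x. x \<in> {0..1} \<Longrightarrow> y x = 0" and "k < 4" "x \<in> {0..1}"
  shows "quasi_deriv \<tau>1 \<tau>2 y k x = 0"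
proof -
  have Z: "system.solves 0 (\<lambda>i x. 0)"
    using system.solves_linear_combination[of "{}"] by simp
  have "(\<lambda>x. 0) \<in> D_F \<tau>1 \<tau>2" using solves_imp_solution(1)[OF Z] by (simp add: solution_def)
  then have "quasi_deriv \<tau>1 \<tau>2 y k x = quasi_deriv \<tau>1 \<tau>2 (\<lambda>x. 0) k x"
    using quasi_chain_unique(1)[OF quasi_chain_quasi_deriv quasi_chain_quasi_deriv, of y "\<lambda>x. 0" k] assms by auto
  then show ?thesis using solves_imp_solution(2)[OF Z] assms by simp
qed

end

section \<open>Spectra as zero sets of minors\<close>

context quasi_differential_expression
begin

definition minor :: "complex \<Rightarrow> nat \<Rightarrow> nat \<Rightarrow> complex" where
  "minor \<mu> k l = V_form \<tau>1 \<tau>2 3 (C_sol \<tau>1 \<tau>2 k \<mu>) * V_form \<tau>1 \<tau>2 4 (C_sol \<tau>1 \<tau>2 l \<mu>)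
               - V_form \<tau>1 \<tau>2 3 (C_sol \<tau>1 \<tau>2 l \<mu>) * V_form \<tau>1 \<tau>2 4 (C_sol \<tau>1 \<tau>2 k \<mu>)"

lemma V_form_eq: "V_form \<tau>1 \<tau>2 3 y = quasi_deriv \<tau>1 \<tau>2 y 2 1" "V_form \<tau>1 \<tau>2 4 y = quasi_deriv \<tau>1 \<tau>2 y 0 1"
  by (simp_all add: V_form_def numeral_3_eq_3)

lemma minor_eq_fundamental: "minor \<mu> k l = fundamental \<mu> k 2 1 * fundamental \<mu> l 0 1 - fundamental \<mu> l 2 1 * fundamental \<mu> k 0 1"
  by (simp add: minor_def V_form_eq fundamental_def)

text \<open>The conditions at \<open>0\<close> leave the combinations of \<open>C\<^sub>k\<close> and \<open>C\<^sub>l\<close>, and those at \<open>1\<close> are two linear equations for the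
  coefficients, with determinant \<open>minor \<mu> k l\<close>. A nonzero pair of coefficients gives a function that is
  nonzero somewhere on \<open>[0,1]\<close>, since the coefficients are quasi-derivatives at \<open>0\<close>.\<close>
lemma spectrum_iff_minor_eq_0:
  assumes ijkl: "{i, j, k, l} = {1..4}" and dist: "distinct [i, j, k, l]"
  shows "\<mu> \<in> spectrum_S \<tau>1 \<tau>2 i j \<longleftrightarrow> minor \<mu> k l = 0"
proof
  have mem: "i \<in> {1..4}" "j \<in> {1..4}" "k \<in> {1..4}" "l \<in> {1..4}" using ijkl by auto
  {
    assume "\<mu> \<in> spectrum_S \<tau>1 \<tau>2 i j"
    then obtain y x where y: "solution \<tau>1 \<tau>2 \<mu> y" and x: "x \<in> {0..1}" "y x \<noteq> 0"
      and U: "U_form \<tau>1 \<tau>2 i y = 0" "U_form \<tau>1 \<tau>2 j y = 0"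
      and V: "V_form \<tau>1 \<tau>2 3 y = 0" "V_form \<tau>1 \<tau>2 4 y = 0"
      unfolding spectrum_S_def by blast
    define a b where "a = U_form \<tau>1 \<tau>2 k y" and "b = U_form \<tau>1 \<tau>2 l y"
    have exp: "quasi_deriv \<tau>1 \<tau>2 y m t = a * fundamental \<mu> k m t + b * fundamental \<mu> l m t" if "m < 4" "t \<in> {0..1}" for m t
      unfolding quasi_deriv_expansion[OF y that] ijkl[symmetric]
      using dist U by (simp add: a_def b_def)
    have "quasi_chain \<tau>1 \<tau>2 y (quasi_deriv \<tau>1 \<tau>2 y)"
      using y by (intro quasi_chain_quasi_deriv) (simp add: solution_def)
    then have "quasi_deriv \<tau>1 \<tau>2 y 0 = y" by (simp add: quasi_chain_def)
    then have "y x = a * fundamental \<mu> k 0 x + b * fundamental \<mu> l 0 x" using exp[of 0 x] x by simp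
    then have ab: "a \<noteq> 0 \<or> b \<noteq> 0" using x by auto
    have 1: "a * fundamental \<mu> k 2 1 + b * fundamental \<mu> l 2 1 = 0" "a * fundamental \<mu> k 0 1 + b * fundamental \<mu> l 0 1 = 0"
      using V exp[of 2 1] exp[of 0 1] by (simp_all add: V_form_eq)
    have "a * minor \<mu> k l = (a * fundamental \<mu> k 2 1 + b * fundamental \<mu> l 2 1) * fundamental \<mu> l 0 1 - fundamental \<mu> l 2 1 * (a * fundamental \<mu> k 0 1 + b * fundamental \<mu> l 0 1)"
      "b * minor \<mu> k l = (a * fundamental \<mu> k 0 1 + b * fundamental \<mu> l 0 1) * fundamental \<mu> k 2 1 - fundamental \<mu> k 0 1 * (a * fundamental \<mu> k 2 1 + b * fundamental \<mu> l 2 1)"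
      by (simp_all add: minor_eq_fundamental algebra_simps)
    then show "minor \<mu> k l = 0" using ab unfolding 1 by auto
  }
  {
    assume "minor \<mu> k l = 0"
    then have "fundamental \<mu> k 2 1 * fundamental \<mu> l 0 1 - fundamental \<mu> l 2 1 * fundamental \<mu> k 0 1 = 0" by (simp add: minor_eq_fundamental)
    then obtain a b where ab: "(a, b) \<noteq> (0, 0)"
      and 1: "a * fundamental \<mu> k 2 1 + b * fundamental \<mu> l 2 1 = 0" "a * fundamental \<mu> k 0 1 + b * fundamental \<mu> l 0 1 = 0"
      by (rule singular_2x2_kernel)
    define Y where "Y i x = a * fundamental \<mu> k i x + b * fundamental \<mu> l i x" for i x
    have Y: "system.solves \<mu> Y" unfolding Y_def[abs_def] by (rule combination_of_two_solves) (use mem in auto)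
    note qd = solves_imp_solution(2)[OF Y]
    have sol: "solution \<tau>1 \<tau>2 \<mu> (Y 0)" by (rule solves_imp_solution(1)[OF Y])
    have U: "U_form \<tau>1 \<tau>2 s (Y 0) = a * (if s = k then 1 else 0) + b * (if s = l then 1 else 0)"
      if "s \<in> {1..4}" for s
      using qd[of "s - 1" 0] that mem by (auto simp: U_form_def Y_def fundamental_initial)
    have "\<exists>x\<in>{0..1}. Y 0 x \<noteq> 0"
    proof (rule ccontr)
      assume "\<not> (\<exists>x\<in>{0..1}. Y 0 x \<noteq> 0)"
      then have "U_form \<tau>1 \<tau>2 s (Y 0) = 0" if "s \<in> {1..4}" for s
        unfolding U_form_def using sol that by (intro quasi_deriv_eq_0) (auto simp: solution_def)
      then show False using U[OF mem(3)] U[OF mem(4)] mem dist ab by auto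
    qed
    moreover have "V_form \<tau>1 \<tau>2 3 (Y 0) = 0" "V_form \<tau>1 \<tau>2 4 (Y 0) = 0"
      using qd[of 2 1] qd[of 0 1] 1 by (simp_all add: V_form_eq Y_def)
    moreover have "U_form \<tau>1 \<tau>2 i (Y 0) = 0" "U_form \<tau>1 \<tau>2 j (Y 0) = 0"
      using U mem dist by auto
    ultimately show "\<mu> \<in> spectrum_S \<tau>1 \<tau>2 i j" unfolding spectrum_S_def using sol by blast
  }
qed

text \<open>Lagrange's identity makes the transfer matrix from \<open>0\<close> to \<open>1\<close> symplectic. The claim is that its rows 0 and 2, which
  represent \<open>V\<^sub>4\<close> and \<open>V\<^sub>3\<close>, are orthogonal.\<close>
lemma minor_1_4_eq_minor_2_3: "minor \<mu> 1 4 = minor \<mu> 2 3"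
proof -
  have "(\<Sum>i<4. (-1) ^ i * fundamental \<mu> (Suc k) i 1 * fundamental \<mu> (Suc l) (4 - 1 - i) 1) = (if k + l = 4 - 1 then (-1) ^ k else 0)"
    if kl: "k < 4" "l < 4" for k l
  proof -
    have "(\<Sum>i<4. (-1) ^ i * fundamental \<mu> (Suc k) i 1 * fundamental \<mu> (Suc l) (3 - i) 1) =
          (\<Sum>i<4. (-1) ^ i * fundamental \<mu> (Suc k) i 0 * fundamental \<mu> (Suc l) (3 - i) 0)"
      by (rule Lagrange_identity[where \<mu> = \<mu>]) (use kl fundamental_solves in auto)
    also have "\<dots> = (\<Sum>i<4. if i = k then (if k + l = 3 then (-1) ^ k else 0) else 0)"
      by (rule sum.cong) (use kl in \<open>auto simp: fundamental_initial\<close>)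
    also have "\<dots> = (if k + l = 3 then (-1) ^ k else 0)" using kl by simp
    finally show ?thesis by simp
  qed
  from symplectic_transpose[of 4 "\<lambda>i k. fundamental \<mu> (Suc k) i 1", OF this, of 0 2]
  have "(\<Sum>k<4. (-1) ^ k * fundamental \<mu> (Suc k) 0 1 * fundamental \<mu> (Suc (3 - k)) 2 1) = 0" by simp
  then show ?thesis by (simp add: minor_eq_fundamental eval_nat_numeral algebra_simps)
qed

lemma Delta_eq_minor:
  "Delta \<tau>1 \<tau>2 2 2 \<mu> = minor \<mu> 3 4" "Delta \<tau>1 \<tau>2 3 2 \<mu> = minor \<mu> 2 4" "Delta \<tau>1 \<tau>2 4 2 \<mu> = minor \<mu> 3 2"
  by (simp_all add: Delta_def det_mat_2 minor_def)
     (simp_all add: eval_nat_numeral)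

end

theorem lemma3p5:
  fixes \<tau>1 \<tau>2 :: "real \<Rightarrow> complex"
  assumes "L2_01 \<tau>1" and "L2_01 \<tau>2"
    and "class_W \<tau>1 \<tau>2"
  shows
   "spectrum_S \<tau>1 \<tau>2 1 2 = {\<mu>. Delta \<tau>1 \<tau>2 2 2 \<mu> = 0} \<and>
    spectrum_S \<tau>1 \<tau>2 1 3 = {\<mu>. Delta \<tau>1 \<tau>2 3 2 \<mu> = 0} \<and>
    spectrum_S \<tau>1 \<tau>2 2 3 = {\<mu>. Delta \<tau>1 \<tau>2 4 2 \<mu> = 0}"
proof -
  interpret quasi_differential_expression \<tau>1 \<tau>2 by standard (use assms in auto)
  have "minor \<mu> 3 2 = - minor \<mu> 1 4" for \<mu>
    unfolding minor_1_4_eq_minor_2_3 by (simp add: minor_def)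
  then have "minor \<mu> 3 2 = 0 \<longleftrightarrow> minor \<mu> 1 4 = 0" for \<mu> by simp
  moreover have "\<mu> \<in> spectrum_S \<tau>1 \<tau>2 1 2 \<longleftrightarrow> minor \<mu> 3 4 = 0"
    "\<mu> \<in> spectrum_S \<tau>1 \<tau>2 1 3 \<longleftrightarrow> minor \<mu> 2 4 = 0"
    "\<mu> \<in> spectrum_S \<tau>1 \<tau>2 2 3 \<longleftrightarrow> minor \<mu> 1 4 = 0" for \<mu>
    by (intro spectrum_iff_minor_eq_0; auto)+
  ultimately show ?thesis unfolding Delta_eq_minor by blast
qed

end
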